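(* $[\tau(\mathbf{SemConv})\mathbf{Txt}\mathbf{Sd}\mathbf{Bc}] = [\tau(\mathbf{SemConv})\mathbf{Txt}\mathbf{Psd}\mathbf{Bc}] = [\tau(\mathbf{SemConv})\mathbf{Txt}\mathbf{G}\mathbf{Bc}]$.
   Context: Fix an acceptable numbering $(\varphi_e)$ of partial computable functions, $W_e=\mathrm{dom}(\varphi_e)$. A text is a total function $T:\mathbb N\to\mathbb N\cup\{\#\}$, $\mathrm{content}(T)=\mathrm{range}(T)\setminus\{\#\}$, $T[n]=(T(0),\dots,T(n-1))$; $\mathbf{Txt}$ is the set of all texts, $\mathbf{Txt}(L)$ those with content $L$. Learners are partial computable functions; $\mathbf G(h,T)(i)=h(T[i])$, $\mathbf{Psd}(h,T)(i)=h(\mathrm{content}(T[i]),i)$, $\mathbf{Sd}(h,T)(i)=h(\mathrm{content}(T[i]))$. For total $p:\mathbb N\to\mathbb N$ and text $T$: $\mathbf{Bc}(p,T)$ iff $\exists n_0\,\forall n\ge n_0: W_{p(n)}=\mathrm{content}(T)$; $\mathbf{SemConv}(p,T)$ iff for all $n<m$ with $\mathrm{content}(T[m])\subseteq W_{p(n)}$ we have $W_{p(n)}=W_{p(m)}$. A learner $h$ $\tau(\mathbf{SemConv})\mathbf{Txt}\beta\mathbf{Bc}$-learns $L$ iff for every $T\in\mathbf{Txt}$, $\beta(h,T)$ is total and $\mathbf{SemConv}(\beta(h,T),T)$ holds, and for every $T\in\mathbf{Txt}(L)$, $\mathbf{Bc}(\beta(h,T),T)$ holds. $[\cdot]$ is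 the set of classes learnable by a single learner under the criterion. *)

theory Defs
  imports Main "HOL-Library.Nat_Bijection"
begin

datatype recf =
    Zero
  | Succ
  | Proj nat
  | Comp recf "recf list"
  | Prec recf recf
  | Mu recf

inductive eval :: "recf \<Rightarrow> nat list \<Rightarrow> nat \<Rightarrow> bool" where
  eval_Zero: "eval Zero xs 0"
| eval_Succ: "eval Succ (x # xs) (Suc x)"
| eval_Proj: "i < length xs \<Longrightarrow> eval (Proj i) xs (xs ! i)"
| eval_Comp: "length ys = length gs \<Longrightarrow> (\<forall>i<length gs. eval (gs ! i) xs (ys ! i))
      \<Longrightarrow> eval f ys z \<Longrightarrow> eval (Comp f gs) xs z"
| eval_Prec0: "eval f xs y \<Longrightarrow> eval (Prec f g) (0 # xs) y"
| eval_PrecS: "eval (Prec f g) (n # xs) y \<Longrightarrow> eval g (y # n # xs) z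
      \<Longrightarrow> eval (Prec f g) (Suc n # xs) z"
| eval_Mu: "eval f (z # xs) 0 \<Longrightarrow> (\<forall>y<z. \<exists>v. v \<noteq> 0 \<and> eval f (y # xs) v)
      \<Longrightarrow> eval (Mu f) xs z"

definition partial_computable :: "(nat \<Rightarrow> nat option) \<Rightarrow> bool" where
  "partial_computable f \<longleftrightarrow> (\<exists>r. \<forall>x y. f x = Some y \<longleftrightarrow> eval r [x] y)"

definition partial_computable2 :: "(nat \<Rightarrow> nat \<Rightarrow> nat option) \<Rightarrow> bool" where
  "partial_computable2 f \<longleftrightarrow> (\<exists>r. \<forall>x z y. f x z = Some y \<longleftrightarrow> eval r [x, z] y)"

definition total_computable :: "(nat \<Rightarrow> nat) \<Rightarrow> bool" where
  "total_computable g \<longleftrightarrow> partial_computable (\<lambda>x. Some (g x))"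

definition acceptable_numbering :: "(nat \<Rightarrow> nat \<Rightarrow> nat option) \<Rightarrow> bool" where
  "acceptable_numbering \<phi> \<longleftrightarrow> partial_computable2 \<phi> \<and>
     (\<forall>\<psi>. partial_computable2 \<psi> \<longrightarrow>
        (\<exists>g. total_computable g \<and> (\<forall>i. \<psi> i = \<phi> (g i))))"

definition W :: "(nat \<Rightarrow> nat \<Rightarrow> nat option) \<Rightarrow> nat \<Rightarrow> nat set" where
  "W \<phi> e = {x. \<phi> e x \<noteq> None}"

text \<open>A text is a total function nat \<Rightarrow> nat \<union> {#}; None plays the role of #.\<close>
type_synonym lang_text = "nat \<Rightarrow> nat option"

definition content :: "lang_text \<Rightarrow> nat set" where
  "content T = {x. \<exists>i. T i = Some x}"

definition prefix :: "lang_text \<Rightarrow> nat \<Rightarrow> nat option list" where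
  "prefix T n = map T [0..<n]"

definition content_list :: "nat option list \<Rightarrow> nat set" where
  "content_list xs = {x. Some x \<in> set xs}"

text \<open>Codings of the learner inputs as natural numbers (learners are partial computable
  functions on codes): finite sequences over nat \<union> {#}, finite sets (canonical index),
  and pairs.\<close>
definition code_seq :: "nat option list \<Rightarrow> nat" where
  "code_seq xs = list_encode (map (\<lambda>v. case v of None \<Rightarrow> 0 | Some x \<Rightarrow> Suc x) xs)"

datatype interaction = Gold | PartSetDriven | SetDriven

fun interact :: "interaction \<Rightarrow> (nat \<Rightarrow> nat option) \<Rightarrow> lang_text \<Rightarrow> nat \<Rightarrow> nat option" where
  "interact Gold h T i = h (code_seq (prefix T i))"
| "interact PartSetDriven h T i = h (prod_encode (set_encode (content_list (prefix T i)), i))"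
| "interact SetDriven h T i = h (set_encode (content_list (prefix T i)))"

definition Bc :: "(nat \<Rightarrow> nat \<Rightarrow> nat option) \<Rightarrow> (nat \<Rightarrow> nat) \<Rightarrow> lang_text \<Rightarrow> bool" where
  "Bc \<phi> p T \<longleftrightarrow> (\<exists>n0. \<forall>n\<ge>n0. W \<phi> (p n) = content T)"

definition SemConv :: "(nat \<Rightarrow> nat \<Rightarrow> nat option) \<Rightarrow> (nat \<Rightarrow> nat) \<Rightarrow> lang_text \<Rightarrow> bool" where
  "SemConv \<phi> p T \<longleftrightarrow> (\<forall>n m. n < m \<and> content_list (prefix T m) \<subseteq> W \<phi> (p n)
       \<longrightarrow> W \<phi> (p n) = W \<phi> (p m))"

definition learns :: "(nat \<Rightarrow> nat \<Rightarrow> nat option) \<Rightarrow> interaction \<Rightarrow> (nat \<Rightarrow> nat option) \<Rightarrow> nat set \<Rightarrow> bool" where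
  "learns \<phi> \<beta> h L \<longleftrightarrow>
     partial_computable h \<and>
     (\<forall>T. (\<forall>i. interact \<beta> h T i \<noteq> None) \<and>
          SemConv \<phi> (\<lambda>i. the (interact \<beta> h T i)) T) \<and>
     (\<forall>T. content T = L \<longrightarrow> Bc \<phi> (\<lambda>i. the (interact \<beta> h T i)) T)"

definition learnable_classes :: "(nat \<Rightarrow> nat \<Rightarrow> nat option) \<Rightarrow> interaction \<Rightarrow> nat set set set" where
  "learnable_classes \<phi> \<beta> = {\<L>. \<exists>h. partial_computable h \<and> (\<forall>L\<in>\<L>. learns \<phi> \<beta> h L)}"

end

theory Submission
  imports Defs
begin

text \<open>
  For a semantically conservative Gold-style learner \<open>h\<close>, let \<open>A \<sigma>\<close> be the language conjectured on the
  sequence \<open>\<sigma>\<close>. Call \<open>\<sigma>\<close> a candidate for a finite set \<open>D\<close> if \<open>content \<sigma> \<subseteq> D \<subseteq> A \<sigma>\<close>, and let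
  \<open>hull \<sigma> D\<close> be the closure of \<open>D\<close> under the conjectures of \<open>h\<close> on extensions of \<open>\<sigma>\<close>. The set-driven
  learner would like to follow the least candidate, which cannot be computed. Instead each candidate
  \<open>\<sigma>\<close> proposes the elements that lie in \<open>hull \<sigma>' D\<close> for all \<open>\<sigma>' \<le> \<sigma>\<close> over \<open>D\<close> and that are in \<open>D\<close> or
  too large to occur in any \<open>\<sigma>' \<le> \<sigma>\<close>. These proposals decrease with \<open>\<sigma>\<close>, so their union, which is
  uniformly recursively enumerable, is the proposal of the least candidate. Growing \<open>D\<close> within this
  proposal creates neither new sequences below \<open>\<sigma>\<close> nor new candidates among them and does not change
  the hulls, so the new learner is semantically conservative. If \<open>h\<close> learns \<open>L\<close>, then finitely many
  elements of \<open>L\<close> rule out all sequences below the least \<open>\<sigma>\<close> with \<open>A \<sigma> = L\<close> and, since every sequence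
  over \<open>L\<close> extends to one on which \<open>h\<close> conjectures \<open>L\<close>, make all relevant hulls contain \<open>L\<close>.
\<close>

section \<open>Recursive functions on numbers\<close>

inductive_simps eval_Zero_iff [simp]: "eval Zero xs y"
inductive_simps eval_Succ_iff: "eval Succ xs y"
inductive_simps eval_Proj_iff [simp]: "eval (Proj i) xs y"
inductive_simps eval_Comp_iff': "eval (Comp f gs) xs z"
inductive_simps eval_Prec_Nil [simp]: "eval (Prec f g) [] y"
inductive_simps eval_Prec_0 [simp]: "eval (Prec f g) (0 # xs) y"
inductive_simps eval_Prec_Suc [simp]: "eval (Prec f g) (Suc n # xs) z"
inductive_simps eval_Mu_iff: "eval (Mu f) xs z"

lemma eval_Comp_iff: "eval (Comp f gs) xs z \<longleftrightarrow>
  (\<exists>ys. list_all2 (\<lambda>g y. eval g xs y) gs ys \<and> eval f ys z)"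
  unfolding eval_Comp_iff' list_all2_conv_all_nth by metis

lemma eval_det: "eval r xs y \<Longrightarrow> eval r xs z \<Longrightarrow> y = z"
proof (induction r xs y arbitrary: z rule: eval.induct)
  case (eval_Comp ys gs xs f w)
  from eval_Comp.prems obtain ys' where ys': "length ys' = length gs"
    "\<forall>i<length gs. eval (gs ! i) xs (ys' ! i)" "eval f ys' z"
    unfolding eval_Comp_iff' by auto
  have "ys = ys'"
    using eval_Comp.hyps(1) eval_Comp.IH(1) ys' by (intro nth_equalityI) auto
  then show ?case
    using eval_Comp.IH(2) ys'(3) by blast
next
  case (eval_PrecS f g n xs y w)
  then show ?case
    unfolding eval_Prec_Suc by metis
next
  case (eval_Mu f w xs)
  from eval_Mu.prems have z: "eval f (z # xs) 0" "\<forall>y<z. \<exists>v. v \<noteq> 0 \<and> eval f (y # xs) v"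
    by (auto simp: eval_Mu_iff)
  show ?case
    using eval_Mu.IH z by (metis linorder_neqE_nat)
qed (auto simp: eval_Succ_iff)

text \<open>The recursion is unfolded into a table \<open>s\<close> of intermediate values. In this
  form a run of \<open>Prec\<close> can be certified by a single number that codes the
  table.\<close>

lemma eval_Prec_iff: "eval (Prec f g) (n # xs) y \<longleftrightarrow>
  (\<exists>s. eval f xs (s 0) \<and> (\<forall>k<n. eval g (s k # k # xs) (s (Suc k))) \<and> s n = y)"
proof (induction n arbitrary: y)
  case 0
  then show ?case by (auto intro: exI[of _ "\<lambda>_. y"])
next
  case (Suc n)
  show ?case
  proof
    assume "eval (Prec f g) (Suc n # xs) y"
    then obtain s where s: "eval f xs (s 0)" "\<forall>k<n. eval g (s k # k # xs) (s (Suc k))"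
      "eval g (s n # n # xs) y"
      using Suc.IH by auto
    show "\<exists>s. eval f xs (s 0) \<and> (\<forall>k<Suc n. eval g (s k # k # xs) (s (Suc k))) \<and> s (Suc n) = y"
      by (rule exI[of _ "s(Suc n := y)"]) (use s in \<open>auto simp: less_Suc_eq\<close>)
  next
    assume "\<exists>s. eval f xs (s 0) \<and> (\<forall>k<Suc n. eval g (s k # k # xs) (s (Suc k))) \<and> s (Suc n) = y"
    then obtain s where "eval f xs (s 0)" "\<forall>k<Suc n. eval g (s k # k # xs) (s (Suc k))"
      "s (Suc n) = y"
      by blast
    moreover from this have "eval (Prec f g) (n # xs) (s n)"
      unfolding Suc.IH by (intro exI[of _ s]) auto
    ultimately show "eval (Prec f g) (Suc n # xs) y"
      unfolding eval_Prec_Suc by (intro exI[of _ "s n"]) auto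
  qed
qed

section \<open>Total functions of fixed arity and basic arithmetic\<close>

definition computable_on :: "nat \<Rightarrow> (nat list \<Rightarrow> nat) \<Rightarrow> bool" where
  "computable_on n f \<longleftrightarrow> (\<exists>r. \<forall>xs. length xs = n \<longrightarrow> eval r xs (f xs))"

lemma computable_on_nth: "i < n \<Longrightarrow> computable_on n (\<lambda>xs. xs ! i)"
  unfolding computable_on_def by (metis eval_Proj)

lemma computable_on_Suc:
  assumes "computable_on n f" shows "computable_on n (\<lambda>xs. Suc (f xs))"
proof -
  obtain r where r: "\<And>xs. length xs = n \<Longrightarrow> eval r xs (f xs)"
    using assms by (auto simp: computable_on_def)
  have "eval (Comp Succ [r]) xs (Suc (f xs))" if "length xs = n" for xs
    unfolding eval_Comp_iff using r[OF that] by (intro exI[of _ "[f xs]"]) (simp add: eval_Succ)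
  then show ?thesis by (auto simp: computable_on_def)
qed

lemma computable_on_const: "computable_on n (\<lambda>_. c)"
proof (induction c)
  case 0
  show ?case unfolding computable_on_def by (metis eval_Zero)
next
  case (Suc c)
  then show ?case by (rule computable_on_Suc)
qed

lemma computable_on_comp:
  assumes "computable_on (length gs) f" "\<forall>g\<in>set gs. computable_on n g"
  shows "computable_on n (\<lambda>xs. f (map (\<lambda>g. g xs) gs))"
proof -
  obtain r where r: "\<And>xs. length xs = length gs \<Longrightarrow> eval r xs (f xs)"
    using assms(1) by (auto simp: computable_on_def)
  obtain q where q: "\<And>g xs. g \<in> set gs \<Longrightarrow> length xs = n \<Longrightarrow> eval (q g) xs (g xs)"
    using assms(2) unfolding computable_on_def by metis
  have "eval (Comp r (map q gs)) xs (f (map (\<lambda>g. g xs) gs))" if "length xs = n" for xs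
    unfolding eval_Comp_iff using r q that
    by (intro exI[of _ "map (\<lambda>g. g xs) gs"]) (auto simp: list_all2_conv_all_nth)
  then show ?thesis by (auto simp: computable_on_def)
qed

lemma computable_on_comp1:
  "computable_on 1 (\<lambda>xs. f (xs ! 0)) \<Longrightarrow> computable_on n g \<Longrightarrow> computable_on n (\<lambda>xs. f (g xs))"
  using computable_on_comp[of "[g]" "\<lambda>xs. f (xs ! 0)" n] by simp

lemma computable_on_comp2:
  "computable_on 2 (\<lambda>xs. f (xs ! 0) (xs ! 1)) \<Longrightarrow> computable_on n g \<Longrightarrow> computable_on n h
    \<Longrightarrow> computable_on n (\<lambda>xs. f (g xs) (h xs))"
  using computable_on_comp[of "[g, h]" "\<lambda>xs. f (xs ! 0) (xs ! 1)" n] by (simp add: numeral_2_eq_2)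

lemma computable_on_rec:
  assumes "computable_on n f" "computable_on (Suc (Suc n)) g"
  shows "computable_on (Suc n) (\<lambda>xs. rec_nat (f (tl xs)) (\<lambda>k a. g (a # k # tl xs)) (hd xs))"
proof -
  obtain r where r: "\<And>xs. length xs = n \<Longrightarrow> eval r xs (f xs)"
    using assms(1) by (auto simp: computable_on_def)
  obtain q where q: "\<And>xs. length xs = Suc (Suc n) \<Longrightarrow> eval q xs (g xs)"
    using assms(2) by (auto simp: computable_on_def)
  have "eval (Prec r q) (m # xs) (rec_nat (f xs) (\<lambda>k a. g (a # k # xs)) m)"
    if "length xs = n" for m xs
    using that by (induction m) (use r q in auto)
  then have "eval (Prec r q) xs (rec_nat (f (tl xs)) (\<lambda>k a. g (a # k # tl xs)) (hd xs))"
    if "length xs = Suc n" for xs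
    using that by (cases xs) auto
  then show ?thesis by (auto simp: computable_on_def)
qed

lemma computable_on_cong:
  "computable_on n f \<Longrightarrow> (\<And>xs. length xs = n \<Longrightarrow> f xs = g xs) \<Longrightarrow> computable_on n g"
  by (metis computable_on_def)

lemma computable_on_rec2:
  assumes "computable_on 1 (\<lambda>xs. f (xs ! 0))"
    and "computable_on 3 (\<lambda>xs. g (xs ! 0) (xs ! 1) (xs ! 2))"
  shows "computable_on 2 (\<lambda>xs. rec_nat (f (xs ! 1)) (\<lambda>k a. g a k (xs ! 1)) (xs ! 0))"
proof (rule computable_on_cong)
  show "computable_on 2 (\<lambda>xs. rec_nat (f (tl xs ! 0)) (\<lambda>k a. g ((a # k # tl xs) ! 0)
      ((a # k # tl xs) ! 1) ((a # k # tl xs) ! 2)) (hd xs))"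
    using computable_on_rec[of 1 _ "\<lambda>xs. g (xs ! 0) (xs ! 1) (xs ! 2)", OF assms(1)] assms(2)
    by (simp add: numeral_eq_Suc)
qed (auto simp: numeral_eq_Suc length_Suc_conv)

lemma computable_on_add:
  "computable_on n f \<Longrightarrow> computable_on n g \<Longrightarrow> computable_on n (\<lambda>xs. f xs + g xs)"
proof (rule computable_on_comp2[where f = "(+)"])
  have "computable_on 2 (\<lambda>xs. rec_nat (xs ! 1) (\<lambda>k a. Suc a) (xs ! 0))"
    by (rule computable_on_rec2[where g = "\<lambda>a k x. Suc a"])
      (auto intro!: computable_on_Suc computable_on_nth)
  moreover have "rec_nat x (\<lambda>k a. Suc a) n = n + x" for x n :: nat by (induction n) auto
  ultimately show "computable_on 2 (\<lambda>xs. xs ! 0 + xs ! 1)" by simp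
qed

lemma computable_on_pred:
  "computable_on n f \<Longrightarrow> computable_on n (\<lambda>xs. f xs - 1)"
\<comment> \<open>The recursion scheme \<open>computable_on_rec2\<close> carries a parameter, so the
  predecessor is obtained as a binary function with a dummy second argument.\<close>
proof (rule computable_on_comp2[where f = "\<lambda>x y. x - 1"])
  have "computable_on 2 (\<lambda>xs. rec_nat 0 (\<lambda>k a. k) (xs ! 0))"
    by (rule computable_on_rec2[where g = "\<lambda>a k x. k" and f = "\<lambda>x. 0"])
      (auto intro!: computable_on_const computable_on_nth)
  moreover have "rec_nat 0 (\<lambda>k a. k) n = n - 1" for n :: nat by (cases n) auto
  ultimately show "computable_on 2 (\<lambda>xs. xs ! 0 - 1)" by simp
qed

lemma computable_on_diff:
  "computable_on n f \<Longrightarrow> computable_on n g \<Longrightarrow> computable_on n (\<lambda>xs. f xs - g xs)"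
\<comment> \<open>Recursion runs on the first argument, and it is the subtrahend that counts the
  applications of the predecessor; hence the exchanged order.\<close>
proof (rule computable_on_comp2[where f = "\<lambda>x y. y - x" and g = g and h = f])
  have "computable_on 2 (\<lambda>xs. rec_nat (xs ! 1) (\<lambda>k a. a - 1) (xs ! 0))"
    by (rule computable_on_rec2[where g = "\<lambda>a k x. a - 1"])
      (auto intro!: computable_on_pred[simplified] computable_on_nth)
  moreover have "rec_nat x (\<lambda>k a. a - 1) n = x - n" for x n :: nat by (induction n) auto
  ultimately show "computable_on 2 (\<lambda>xs. xs ! 1 - xs ! 0)" by simp
qed

lemma computable_on_mult:
  "computable_on n f \<Longrightarrow> computable_on n g \<Longrightarrow> computable_on n (\<lambda>xs. f xs * g xs)"
proof (rule computable_on_comp2[where f = "(*)"])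
  have "computable_on 2 (\<lambda>xs. rec_nat 0 (\<lambda>k a. a + xs ! 1) (xs ! 0))"
    by (rule computable_on_rec2[where g = "\<lambda>a k x. a + x" and f = "\<lambda>x. 0"])
      (auto intro!: computable_on_add computable_on_nth computable_on_const)
  moreover have "rec_nat 0 (\<lambda>k a. a + x) n = n * x" for x n :: nat by (induction n) auto
  ultimately show "computable_on 2 (\<lambda>xs. xs ! 0 * xs ! 1)" by simp
qed

lemma computable_on_triangle:
  "computable_on n f \<Longrightarrow> computable_on n (\<lambda>xs. triangle (f xs))"
proof (rule computable_on_comp2[where f = "\<lambda>x y. triangle x"])
  have "computable_on 2 (\<lambda>xs. rec_nat 0 (\<lambda>k a. a + Suc k) (xs ! 0))"
    by (rule computable_on_rec2[where g = "\<lambda>a k x. a + Suc k" and f = "\<lambda>x. 0"])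
      (auto intro!: computable_on_add computable_on_Suc computable_on_nth computable_on_const)
  moreover have "rec_nat 0 (\<lambda>k a. a + Suc k) n = triangle n" for n :: nat by (induction n) auto
  ultimately show "computable_on 2 (\<lambda>xs. triangle (xs ! 0))" by simp
qed

lemma computable_on_pair:
  "computable_on n f \<Longrightarrow> computable_on n g \<Longrightarrow> computable_on n (\<lambda>xs. prod_encode (f xs, g xs))"
  by (simp add: prod_encode_def computable_on_add computable_on_triangle)

definition pfst :: "nat \<Rightarrow> nat" where "pfst z = fst (prod_decode z)"
definition psnd :: "nat \<Rightarrow> nat" where "psnd z = snd (prod_decode z)"

lemma pfst_encode [simp]: "pfst (prod_encode (x, y)) = x"
  and psnd_encode [simp]: "psnd (prod_encode (x, y)) = y"
  and encode_pfst_psnd [simp]: "prod_encode (pfst z, psnd z) = z"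
  by (simp_all add: pfst_def psnd_def)

lemma pfst_0 [simp]: "pfst 0 = 0" and psnd_0 [simp]: "psnd 0 = 0"
  using pfst_encode[of 0 0] psnd_encode[of 0 0]
  by (simp_all add: prod_encode_def del: pfst_encode psnd_encode)

text \<open>The index of the diagonal of the Cantor pairing on which \<open>z\<close> lies.\<close>

definition diagonal :: "nat \<Rightarrow> nat" where
  "diagonal = rec_nat 0 (\<lambda>k a. a + (1 - (triangle (Suc a) - Suc k)))"

text \<open>The truncated difference in \<open>diagonal\<close> is an arithmetic test: it adds one
  exactly when \<open>Suc k\<close> has reached the next triangular number.\<close>

lemma diagonal_bounds: "triangle (diagonal z) \<le> z \<and> z < triangle (Suc (diagonal z))"
proof (induction z)
  case 0
  then show ?case by (simp add: diagonal_def)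
next
  case (Suc z)
  have "diagonal (Suc z) = diagonal z + (1 - (triangle (Suc (diagonal z)) - Suc z))"
    by (simp add: diagonal_def)
  then show ?case
    using Suc by (cases "triangle (Suc (diagonal z)) \<le> Suc z") auto
qed

text \<open>Since \<open>prod_encode (x, y)\<close> is \<open>triangle (x + y) + x\<close>, it lies
  between two consecutive triangular numbers, and monotonicity of \<open>triangle\<close> leaves
  only one possible diagonal.\<close>

lemma diagonal_encode: "diagonal (prod_encode (x, y)) = x + y"
proof -
  let ?z = "prod_encode (x, y)"
  have tri: "triangle (x + y) \<le> ?z" "?z < triangle (Suc (x + y))"
    by (auto simp: prod_encode_def)
  have mono: "triangle m \<le> triangle n" if "m \<le> n" for m n
    using that by (rule lift_Suc_mono_le[rotated]) simp
  show ?thesis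
    using tri diagonal_bounds[of ?z] mono[of "Suc (x + y)" "diagonal ?z"]
      mono[of "Suc (diagonal ?z)" "x + y"] by (meson leD le_less_trans less_le_trans not_less_eq_eq nle_le)
qed

text \<open>Computability of unpairing is reduced in this way to that of \<open>diagonal\<close>,
  \<open>triangle\<close> and truncated subtraction.\<close>

lemma pfst_diagonal: "pfst z = z - triangle (diagonal z)"
  and psnd_diagonal: "psnd z = diagonal z - pfst z"
proof -
  have *: "pfst z = z - triangle (diagonal z) \<and> psnd z = diagonal z - pfst z"
    if z: "z = prod_encode (x, y)" for x y
    unfolding z diagonal_encode pfst_encode psnd_encode by (simp add: prod_encode_def)
  show "pfst z = z - triangle (diagonal z)" "psnd z = diagonal z - pfst z"
    using *[of "pfst z" "psnd z"] by simp_all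
qed

section \<open>Computable unary functions, with several arguments coded by pairing\<close>

definition computable :: "(nat \<Rightarrow> nat) \<Rightarrow> bool" where
  "computable f \<longleftrightarrow> computable_on 1 (\<lambda>xs. f (xs ! 0))"

lemma computable_comp: "computable f \<Longrightarrow> computable g \<Longrightarrow> computable (\<lambda>x. f (g x))"
  unfolding computable_def by (rule computable_on_comp1)

named_theorems computable

lemma computable_id [computable]: "computable (\<lambda>x. x)"
  and computable_const [computable]: "computable (\<lambda>x. c)"
  by (simp_all add: computable_def computable_on_const computable_on_nth)

lemma computable_Suc [computable]: "computable f \<Longrightarrow> computable (\<lambda>x. Suc (f x))"
  and computable_triangle [computable]: "computable f \<Longrightarrow> computable (\<lambda>x. triangle (f x))"
  unfolding computable_def by (simp_all only: computable_on_Suc computable_on_triangle)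

lemma
  assumes "computable f" "computable g"
  shows computable_add [computable]: "computable (\<lambda>x. f x + g x)"
    and computable_diff [computable]: "computable (\<lambda>x. f x - g x)"
    and computable_mult [computable]: "computable (\<lambda>x. f x * g x)"
    and computable_pair [computable]: "computable (\<lambda>x. prod_encode (f x, g x))"
  using assms unfolding computable_def
  by (simp_all only: computable_on_add computable_on_diff computable_on_mult computable_on_pair)

lemma computable_diagonal: "computable f \<Longrightarrow> computable (\<lambda>x. diagonal (f x))"
proof (rule computable_comp[of diagonal])
  have *: "computable_on 3 (\<lambda>xs. xs ! 0 + (1 - (triangle (Suc (xs ! 0)) - Suc (xs ! 1))))"
    by (intro computable_on_add computable_on_diff computable_on_triangle computable_on_Suc
        computable_on_nth computable_on_const) auto
  have "computable_on 2 (\<lambda>xs. rec_nat 0 (\<lambda>k a. a + (1 - (triangle (Suc a) - Suc k))) (xs ! 0))"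
    by (rule computable_on_rec2[where f = "\<lambda>x. 0"
          and g = "\<lambda>a k x. a + (1 - (triangle (Suc a) - Suc k))", OF computable_on_const *])
  then have "computable_on 1 (\<lambda>xs. rec_nat 0 (\<lambda>k a. a + (1 - (triangle (Suc a) - Suc k))) (xs ! 0))"
    by (rule computable_on_comp2[where f = "\<lambda>x y. rec_nat 0 (\<lambda>k a. a + (1 - (triangle (Suc a) - Suc k))) x"])
      (auto intro: computable_on_nth)
  then show "computable diagonal"
    by (simp add: computable_def diagonal_def)
qed

lemma computable_pfst [computable]: "computable f \<Longrightarrow> computable (\<lambda>x. pfst (f x))"
  unfolding pfst_diagonal by (intro computable computable_diagonal)

lemma computable_psnd [computable]: "computable f \<Longrightarrow> computable (\<lambda>x. psnd (f x))"
  unfolding psnd_diagonal by (intro computable computable_diagonal)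

text \<open>The argument \<open>x\<close> is both the parameter and, through \<open>b\<close>, the
  source of the number of rounds, so a binary recursion is evaluated at \<open>b x\<close> and
  \<open>x\<close>. The step function reads its three arguments from one nested pair.\<close>

lemma computable_rec:
  assumes "computable f"
    and "computable (\<lambda>z. g (pfst z) (pfst (psnd z)) (psnd (psnd z)))"
    and "computable b"
  shows "computable (\<lambda>x. rec_nat (f x) (\<lambda>k a. g k a x) (b x))"
proof -
  have "computable_on 3 (\<lambda>xs. g (xs ! 1) (xs ! 0) (xs ! 2))"
    using computable_on_comp1[OF assms(2)[unfolded computable_def],
        of 3 "\<lambda>xs. prod_encode (xs ! 1, prod_encode (xs ! 0, xs ! 2))"]
    by (simp add: computable_on_pair computable_on_nth)
  then have "computable_on 2 (\<lambda>xs. rec_nat (f (xs ! 1)) (\<lambda>k a. g k a (xs ! 1)) (xs ! 0))"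
    using computable_on_rec2[of f "\<lambda>a k x. g k a x"] assms(1) by (simp add: computable_def)
  then show ?thesis
    unfolding computable_def
    by (rule computable_on_comp2[where f = "\<lambda>y x. rec_nat (f x) (\<lambda>k a. g k a x) y"])
      (use assms(3) in \<open>auto simp: computable_def intro: computable_on_nth\<close>)
qed

lemma computable_funpow:
  assumes "computable t" "computable i" "computable f"
  shows "computable (\<lambda>x. (t ^^ i x) (f x))"
proof -
  have "rec_nat y (\<lambda>k a. t a) n = (t ^^ n) y" for y n by (induction n) auto
  moreover have "computable (\<lambda>x. rec_nat (f x) (\<lambda>k a. t a) (i x))"
    by (intro computable_rec[where g = "\<lambda>k a x. t a"] computable_comp[OF assms(1)] computable assms)
  ultimately show ?thesis by simp
qed

section \<open>Decidable predicates, bounded quantification and search\<close>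

definition decidable :: "(nat \<Rightarrow> bool) \<Rightarrow> bool" where
  "decidable P \<longleftrightarrow> computable (\<lambda>x. of_bool (P x))"

lemma decidable_comp: "decidable P \<Longrightarrow> computable f \<Longrightarrow> decidable (\<lambda>x. P (f x))"
  unfolding decidable_def by (rule computable_comp)

lemma decidable_comp2:
  "decidable (\<lambda>z. P (pfst z) (psnd z)) \<Longrightarrow> computable f \<Longrightarrow> computable g \<Longrightarrow>
    decidable (\<lambda>x. P (f x) (g x))"
  using decidable_comp[of "\<lambda>z. P (pfst z) (psnd z)" "\<lambda>x. prod_encode (f x, g x)"]
  by (simp add: computable_pair)

lemma decidable_le [computable]:
  assumes "computable f" "computable g" shows "decidable (\<lambda>x. f x \<le> g x)"
proof -
  \<comment> \<open>Truncated subtraction makes this 1 if \<open>f x\<close> is at most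
    \<open>g x\<close>, and 0 otherwise.\<close>
  have "computable (\<lambda>x. 1 - (f x - g x))" by (intro computable assms)
  also have "(\<lambda>x. 1 - (f x - g x)) = (\<lambda>x. of_bool (f x \<le> g x))" by auto
  finally show ?thesis by (simp add: decidable_def)
qed

lemma decidable_not [computable]:
  assumes "decidable P" shows "decidable (\<lambda>x. \<not> P x)"
proof -
  have "computable (\<lambda>x. 1 - of_bool (P x))" by (intro computable assms[unfolded decidable_def])
  also have "(\<lambda>x. 1 - of_bool (P x)) = (\<lambda>x. of_bool (\<not> P x) :: nat)" by auto
  finally show ?thesis by (simp add: decidable_def)
qed

lemma decidable_conj [computable]:
  assumes "decidable P" "decidable Q" shows "decidable (\<lambda>x. P x \<and> Q x)"
  using assms unfolding decidable_def of_bool_conj by (rule computable_mult)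

lemma decidable_disj [computable]:
  assumes "decidable P" "decidable Q" shows "decidable (\<lambda>x. P x \<or> Q x)"
proof -
  have "decidable (\<lambda>x. \<not> (\<not> P x \<and> \<not> Q x))" by (intro computable assms)
  then show ?thesis by simp
qed

lemma decidable_imp [computable]:
  assumes "decidable P" "decidable Q" shows "decidable (\<lambda>x. P x \<longrightarrow> Q x)"
  unfolding imp_conv_disj by (intro computable assms)

lemma decidable_less [computable]:
  assumes "computable f" "computable g" shows "decidable (\<lambda>x. f x < g x)"
  unfolding less_eq_Suc_le by (intro computable assms)

lemma decidable_eq [computable]:
  assumes "computable f" "computable g" shows "decidable (\<lambda>x. f x = g x)"
proof -
  have "decidable (\<lambda>x. f x \<le> g x \<and> g x \<le> f x)" by (intro computable assms)
  then show ?thesis by (simp add: order_eq_iff)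
qed

text \<open>The bounded quantifier is the product of the truth values, formed by recursion on the
  bound.\<close>

lemma decidable_ball [computable]:
  assumes "decidable (\<lambda>z. P (pfst z) (psnd z))" "computable b"
  shows "decidable (\<lambda>x. \<forall>y<b x. P y x)"
proof -
  have "computable (\<lambda>z. of_bool (P (pfst z) (psnd (psnd z))))"
    by (intro decidable_comp2[OF assms(1), unfolded decidable_def] computable)
  then have "computable (\<lambda>x. rec_nat 1 (\<lambda>k a. a * of_bool (P k x)) (b x))"
    by (intro computable_rec[where g = "\<lambda>k a x. a * of_bool (P k x)"] computable assms)
  moreover have "rec_nat 1 (\<lambda>k a. a * of_bool (P k x)) n = (of_bool (\<forall>y<n. P y x) :: nat)" for n x
    by (induction n) (auto simp: less_Suc_eq)
  ultimately show ?thesis by (simp add: decidable_def)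
qed

lemma decidable_bex [computable]:
  assumes "decidable (\<lambda>z. P (pfst z) (psnd z))" "computable b"
  shows "decidable (\<lambda>x. \<exists>y<b x. P y x)"
proof -
  have "decidable (\<lambda>x. \<not> (\<forall>y<b x. \<not> P y x))" by (intro computable assms)
  then show ?thesis by simp
qed

text \<open>Minimisation is applied to the characteristic function of the complement, which vanishes
  exactly where \<open>P\<close> holds. The equivalence also records divergence when there is no
  witness, which is what later yields domains of partial functions.\<close>

lemma eval_search:
  assumes "decidable (\<lambda>z. P (pfst z) (psnd z))"
  shows "\<exists>r. \<forall>x y. eval r [x] y \<longleftrightarrow> P y x \<and> (\<forall>z<y. \<not> P z x)"
proof -
  have "computable (\<lambda>z. 1 - of_bool (P (pfst z) (psnd z)))"
    by (intro computable assms[unfolded decidable_def])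
  then have "computable_on 2 (\<lambda>xs. 1 - of_bool (P (xs ! 0) (xs ! 1)))"
    using computable_on_comp1[of "\<lambda>z. 1 - of_bool (P (pfst z) (psnd z))" 2
        "\<lambda>xs. prod_encode (xs ! 0, xs ! 1)"]
    by (simp add: computable_def computable_on_pair computable_on_nth)
  then obtain q where q: "\<And>xs. length xs = 2 \<Longrightarrow> eval q xs (1 - of_bool (P (xs ! 0) (xs ! 1)))"
    by (auto simp: computable_on_def)
  have q': "eval q [y, x] v \<longleftrightarrow> v = 1 - of_bool (P y x)" for x y v
    using q[of "[y, x]"] eval_det by auto
  have "eval (Mu q) [x] y \<longleftrightarrow> P y x \<and> (\<forall>z<y. \<not> P z x)" for x y
    unfolding eval_Mu_iff by (auto simp: q')
  then show ?thesis by blast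
qed

lemma computable_Least:
  assumes "decidable (\<lambda>z. P (pfst z) (psnd z))" and ex: "\<And>x. \<exists>y. P y x"
  shows "computable (\<lambda>x. LEAST y. P y x)"
proof -
  obtain r where r: "\<And>x y. eval r [x] y \<longleftrightarrow> P y x \<and> (\<forall>z<y. \<not> P z x)"
    using eval_search[OF assms(1)] by blast
  have "eval r [x] (LEAST y. P y x)" for x
    using LeastI_ex[OF ex] not_less_Least unfolding r by blast
  then have "eval r xs (LEAST y. P y (xs ! 0))" if "length xs = 1" for xs
    using that by (auto simp: length_Suc_conv)
  then show ?thesis by (auto simp: computable_def computable_on_def)
qed

section \<open>Semidecidable predicates\<close>

text \<open>In this projection form witnesses can be paired and bounded, which gives the closure
  properties. The link with domains of partial computable functions is
  \<open>semidecidable_domain\<close>.\<close>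

definition semidecidable :: "(nat \<Rightarrow> bool) \<Rightarrow> bool" where
  "semidecidable P \<longleftrightarrow>
     (\<exists>Q. decidable (\<lambda>z. Q (pfst z) (psnd z)) \<and> (\<forall>x. P x \<longleftrightarrow> (\<exists>t. Q t x)))"

lemma semidecidable_comp:
  assumes "semidecidable P" "computable f" shows "semidecidable (\<lambda>x. P (f x))"
proof -
  obtain Q where Q: "decidable (\<lambda>z. Q (pfst z) (psnd z))" "\<And>x. P x \<longleftrightarrow> (\<exists>t. Q t x)"
    using assms(1) unfolding semidecidable_def by blast
  have "decidable (\<lambda>z. Q (pfst z) (f (psnd z)))"
    by (intro decidable_comp2[OF Q(1)] computable_comp[OF assms(2)] computable)
  then show ?thesis unfolding semidecidable_def Q(2) by (intro exI[of _ "\<lambda>t x. Q t (f x)"]) simp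
qed

lemma semidecidable_comp2:
  "semidecidable (\<lambda>z. P (pfst z) (psnd z)) \<Longrightarrow> computable f \<Longrightarrow> computable g \<Longrightarrow>
    semidecidable (\<lambda>x. P (f x) (g x))"
  using semidecidable_comp[of "\<lambda>z. P (pfst z) (psnd z)" "\<lambda>x. prod_encode (f x, g x)"]
  by (simp add: computable)

lemma semidecidable_decidable: "decidable P \<Longrightarrow> semidecidable P"
  unfolding semidecidable_def
  by (rule exI[of _ "\<lambda>t. P"]) (simp add: decidable_comp[of P psnd] computable_psnd[OF computable_id])

lemma semidecidable_ex:
  assumes "semidecidable (\<lambda>z. P (pfst z) (psnd z))"
  shows "semidecidable (\<lambda>x. \<exists>y. P y x)"
proof -
  obtain Q where Q: "decidable (\<lambda>z. Q (pfst z) (psnd z))"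
    "\<And>z. P (pfst z) (psnd z) \<longleftrightarrow> (\<exists>t. Q t z)"
    using assms unfolding semidecidable_def by blast
  have "decidable (\<lambda>z. Q (pfst (pfst z)) (prod_encode (psnd (pfst z), psnd z)))"
    by (intro decidable_comp2[OF Q(1)] computable)
  \<comment> \<open>The witness \<open>s\<close> packs the stage and the value \<open>y\<close> into
    one number.\<close>
  moreover have "(\<exists>y. P y x) \<longleftrightarrow> (\<exists>s. Q (pfst s) (prod_encode (psnd s, x)))" for x
    using Q(2)[of "prod_encode (_, x)"] by (metis pfst_encode psnd_encode)
  ultimately show ?thesis unfolding semidecidable_def
    by (intro exI[of _ "\<lambda>s x. Q (pfst s) (prod_encode (psnd s, x))"]) auto
qed

lemma semidecidable_conj:
  assumes "semidecidable P" "semidecidable Q" shows "semidecidable (\<lambda>x. P x \<and> Q x)"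
proof -
  obtain P' Q' where d: "decidable (\<lambda>z. P' (pfst z) (psnd z))" "decidable (\<lambda>z. Q' (pfst z) (psnd z))"
    and iff: "\<And>x. P x \<longleftrightarrow> (\<exists>t. P' t x)" "\<And>x. Q x \<longleftrightarrow> (\<exists>t. Q' t x)"
    using assms unfolding semidecidable_def by blast
  have "semidecidable (\<lambda>x. \<exists>s t. P' s x \<and> Q' t x)"
    by (intro semidecidable_ex semidecidable_decidable decidable_conj
        decidable_comp2[OF d(1)] decidable_comp2[OF d(2)] computable)
  then show ?thesis by (simp add: iff)
qed

lemma semidecidable_disj:
  assumes "semidecidable P" "semidecidable Q" shows "semidecidable (\<lambda>x. P x \<or> Q x)"
proof -
  obtain P' Q' where d: "decidable (\<lambda>z. P' (pfst z) (psnd z))" "decidable (\<lambda>z. Q' (pfst z) (psnd z))"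
    and iff: "\<And>x. P x \<longleftrightarrow> (\<exists>t. P' t x)" "\<And>x. Q x \<longleftrightarrow> (\<exists>t. Q' t x)"
    using assms unfolding semidecidable_def by blast
  have "semidecidable (\<lambda>x. \<exists>t. P' t x \<or> Q' t x)"
    by (intro semidecidable_ex semidecidable_decidable decidable_disj d)
  then show ?thesis by (simp add: iff ex_disj_distrib)
qed

lemma semidecidable_imp:
  assumes "decidable P" "semidecidable Q" shows "semidecidable (\<lambda>x. P x \<longrightarrow> Q x)"
  unfolding imp_conv_disj
  by (intro semidecidable_disj semidecidable_decidable decidable_not assms)

text \<open>Bounded collection: finitely many witnesses have a common bound \<open>m\<close>, so a
  single existential quantifier over a decidable condition remains.\<close>

lemma semidecidable_ball:
  assumes "semidecidable (\<lambda>z. P (pfst z) (psnd z))" "computable b"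
  shows "semidecidable (\<lambda>x. \<forall>y<b x. P y x)"
proof -
  obtain Q where Q: "decidable (\<lambda>z. Q (pfst z) (psnd z))"
    "\<And>z. P (pfst z) (psnd z) \<longleftrightarrow> (\<exists>t. Q t z)"
    using assms(1) unfolding semidecidable_def by blast
  have "semidecidable (\<lambda>x. \<exists>m. \<forall>y<b x. \<exists>t<m. Q t (prod_encode (y, x)))"
    by (intro semidecidable_ex semidecidable_decidable decidable_ball decidable_bex
        decidable_comp2[OF Q(1)] computable computable_comp[OF assms(2)])
  moreover have "(\<forall>y<b x. P y x) \<longleftrightarrow> (\<exists>m. \<forall>y<b x. \<exists>t<m. Q t (prod_encode (y, x)))" for x
  proof
    assume "\<forall>y<b x. P y x"
    then have "\<forall>y<b x. \<exists>t. Q t (prod_encode (y, x))"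
      by (simp flip: Q(2))
    then obtain t where "\<forall>y<b x. Q (t y) (prod_encode (y, x))" by metis
    then show "\<exists>m. \<forall>y<b x. \<exists>t<m. Q t (prod_encode (y, x))"
      by (intro exI[of _ "Suc (Max (t ` {..<b x}))"]) (auto simp: less_Suc_eq_le intro!: exI[of _ "t _"])
  next
    assume "\<exists>m. \<forall>y<b x. \<exists>t<m. Q t (prod_encode (y, x))"
    then show "\<forall>y<b x. P y x" using Q(2)[of "prod_encode (_, x)"] by simp blast
  qed
  ultimately show ?thesis by simp
qed

section \<open>Coded sequences\<close>

text \<open>\<open>list_encode\<close> sends a nonempty list to the successor of the pair of its
  head and the code of its tail, which explains \<open>s - 1\<close>.\<close>

definition code_hd :: "nat \<Rightarrow> nat" where "code_hd s = pfst (s - 1)"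
definition code_tl :: "nat \<Rightarrow> nat" where "code_tl s = psnd (s - 1)"
definition code_nth :: "nat \<Rightarrow> nat \<Rightarrow> nat" where "code_nth s i = code_hd ((code_tl ^^ i) s)"

lemma list_decode_rec: "list_decode s = (if s = 0 then [] else code_hd s # list_decode (code_tl s))"
  by (cases s) (simp_all add: code_hd_def code_tl_def pfst_def psnd_def split: prod.split)

lemma list_decode_Suc_pair [simp]: "list_decode (Suc (prod_encode (x, s))) = x # list_decode s"
  by simp

lemma list_decode_eq_Nil [simp]: "list_decode s = [] \<longleftrightarrow> s = 0"
  by (simp add: list_decode_rec[of s])

lemma list_decode_code_tl: "list_decode (code_tl s) = tl (list_decode s)"
  by (cases "s = 0") (simp_all add: list_decode_rec[of s], simp add: code_tl_def)

lemma list_decode_funpow: "list_decode ((code_tl ^^ i) s) = drop i (list_decode s)"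
  by (induction i) (simp_all add: list_decode_code_tl tl_drop drop_Suc)

lemma code_hd_0 [simp]: "code_hd 0 = 0"
  by (simp add: code_hd_def)

text \<open>Past the end the iterated tail is the code 0 of the empty list, whose
  \<open>code_hd\<close> is 0; this is the default value.\<close>

lemma code_nth_eq: "code_nth s i = (if i < length (list_decode s) then list_decode s ! i else 0)"
proof (cases "(code_tl ^^ i) s = 0")
  case True
  then have "drop i (list_decode s) = []" by (simp flip: list_decode_funpow)
  with True show ?thesis by (simp add: code_nth_def)
next
  case False
  then have "drop i (list_decode s) = code_nth s i # list_decode (code_tl ((code_tl ^^ i) s))"
    using list_decode_rec[of "(code_tl ^^ i) s"] by (simp add: list_decode_funpow code_nth_def)
  then show ?thesis
    by (metis drop_eq_Nil2 hd_drop_conv_nth leI list.distinct(1) list.sel(1))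
qed

lemma funpow_code_tl_eq_0: "(code_tl ^^ i) s = 0 \<longleftrightarrow> length (list_decode s) \<le> i"
  by (metis drop_eq_Nil2 list_decode_eq_Nil list_decode_funpow)

text \<open>Quantification over tables and finite lists can thus be replaced by quantification over
  numbers.\<close>

lemma ex_code_nth: "\<exists>s. \<forall>i<n. code_nth s i = f i"
  by (rule exI[of _ "list_encode (map f [0..<n])"]) (simp add: code_nth_eq)

text \<open>A code bounds the positions of its list, and by \<open>code_nth_le\<close> also the
  entries. Quantifiers over them are therefore bounded, which keeps predicates on codes
  decidable.\<close>

lemma length_list_decode_le: "length (list_decode s) \<le> s"
proof (induction s rule: less_induct)
  case (less s)
  show ?case
  proof (cases "s = 0")
    case False
    have "code_tl s \<le> s - 1"
      using le_prod_encode_2[of "psnd (s - 1)" "pfst (s - 1)"] by (simp add: code_tl_def)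
    with False have "code_tl s < s" by linarith
    with less[of "code_tl s"] show ?thesis by (simp add: list_decode_rec[of s])
  qed simp
qed

lemma code_nth_le: "code_nth s i \<le> s"
proof -
  have hd: "code_hd s \<le> s" and tl: "code_tl s \<le> s" for s
    using le_prod_encode_1[of "pfst (s - 1)" "psnd (s - 1)"]
      le_prod_encode_2[of "psnd (s - 1)" "pfst (s - 1)"] by (simp_all add: code_hd_def code_tl_def)
  have "(code_tl ^^ i) s \<le> s"
    by (induction i) (auto intro: order_trans[OF tl])
  then show ?thesis unfolding code_nth_def by (rule order_trans[OF hd])
qed

lemma computable_code_hd [computable]: "computable f \<Longrightarrow> computable (\<lambda>x. code_hd (f x))"
  and computable_code_tl [computable]: "computable f \<Longrightarrow> computable (\<lambda>x. code_tl (f x))"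
  unfolding code_hd_def code_tl_def by (intro computable; assumption)+

lemma computable_funpow_code_tl [computable]:
  "computable i \<Longrightarrow> computable f \<Longrightarrow> computable (\<lambda>x. (code_tl ^^ i x) (f x))"
  by (intro computable_funpow computable_code_tl computable_id)

lemma computable_code_nth [computable]:
  "computable f \<Longrightarrow> computable i \<Longrightarrow> computable (\<lambda>x. code_nth (f x) (i x))"
  unfolding code_nth_def by (intro computable)

text \<open>Induction on the program: a run is certified by finitely many intermediate values coded
  as numbers. Argument lists are coded because subprograms take argument lists of different
  lengths.\<close>

lemma semidecidable_eval_decode:
  "semidecidable (\<lambda>z. eval r (list_decode (pfst z)) (psnd z))"
proof (induction r)
  case Zero
  show ?case unfolding eval_Zero_iff by (intro semidecidable_decidable computable)
next
  case Succ
  have "eval Succ (list_decode s) y \<longleftrightarrow> s \<noteq> 0 \<and> y = Suc (code_hd s)" for s y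
    by (subst list_decode_rec) (auto simp: eval_Succ_iff)
  then show ?case by (simp only:) (intro semidecidable_decidable computable)
next
  case (Proj i)
  have "eval (Proj i) (list_decode s) y \<longleftrightarrow> (code_tl ^^ i) s \<noteq> 0 \<and> y = code_nth s i" for s y
    by (auto simp: code_nth_eq funpow_code_tl_eq_0)
  then show ?case by (simp only:) (intro semidecidable_decidable computable)
next
  case (Comp f gs)
  \<comment> \<open>The intermediate values of a composition form one coded list; a separate
    induction over \<open>gs\<close> treats their simultaneous evaluation.\<close>
  have gs: "semidecidable (\<lambda>z. list_all2 (\<lambda>g y. eval g (list_decode (pfst z)) y) gs (list_decode (psnd z)))"
    using Comp.IH(2)
  proof (induction gs)
    case Nil
    show ?case by (simp, intro semidecidable_decidable computable)
  next
    case (Cons g gs)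
    have g: "semidecidable (\<lambda>z. eval g (list_decode (pfst z)) (psnd z))"
      and gs: "semidecidable (\<lambda>z. list_all2 (\<lambda>g y. eval g (list_decode (pfst z)) y) gs (list_decode (psnd z)))"
      using Cons by auto
    have eq: "list_all2 (\<lambda>g y. eval g (list_decode t) y) (g # gs) (list_decode s) \<longleftrightarrow>
      s \<noteq> 0 \<and> eval g (list_decode t) (code_hd s) \<and>
      list_all2 (\<lambda>g y. eval g (list_decode t) y) gs (list_decode (code_tl s))" for s t
      by (subst list_decode_rec) simp
    show ?case unfolding eq
      by (intro semidecidable_conj semidecidable_decidable[OF decidable_not]
          semidecidable_comp2[OF g] semidecidable_comp2[OF gs] computable)
  qed
  have eq: "eval (Comp f gs) xs y \<longleftrightarrow>
    (\<exists>s. list_all2 (\<lambda>g y. eval g xs y) gs (list_decode s) \<and> eval f (list_decode s) y)" for xs y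
    unfolding eval_Comp_iff by (metis list_encode_inverse)
  show ?case unfolding eq
    by (intro semidecidable_ex semidecidable_conj semidecidable_comp2[OF gs]
        semidecidable_comp2[OF Comp.IH(1)] computable)
next
  case (Prec f g)
  \<comment> \<open>\<open>t\<close> codes the arguments with the counter at its head, and
    \<open>s\<close> codes the table of intermediate values from \<open>eval_Prec_iff\<close>. For
    \<open>t = 0\<close> the argument list is empty and \<open>Prec\<close> has no value.\<close>
  have eq: "eval (Prec f g) (list_decode t) y \<longleftrightarrow> t \<noteq> 0 \<and>
    (\<exists>s. eval f (list_decode (code_tl t)) (code_nth s 0) \<and>
      (\<forall>k<code_hd t. eval g (list_decode
          (Suc (prod_encode (code_nth s k, Suc (prod_encode (k, code_tl t))))))
        (code_nth s (Suc k))) \<and> code_nth s (code_hd t) = y)" for t y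
  proof (cases "t = 0")
    case False
    have "(\<exists>s. P (s 0) \<and> (\<forall>k<n. Q k (s k) (s (Suc k))) \<and> s n = y) \<longleftrightarrow>
      (\<exists>s. P (code_nth s 0) \<and> (\<forall>k<n. Q k (code_nth s k) (code_nth s (Suc k))) \<and> code_nth s n = y)"
      (is "?L = ?R") for P Q n
    proof
      assume ?L
      then obtain s where s: "P (s 0)" "\<forall>k<n. Q k (s k) (s (Suc k))" "s n = y" by blast
      moreover obtain c where "\<forall>i<Suc n. code_nth c i = s i" using ex_code_nth by blast
      ultimately show ?R by (intro exI[of _ c]) auto
    qed blast
    with False show ?thesis
      by (subst list_decode_rec) (simp add: eval_Prec_iff)
  qed simp
  show ?case unfolding eq
    by (intro semidecidable_conj semidecidable_ex semidecidable_ball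
        semidecidable_comp2[OF Prec.IH(1)] semidecidable_comp2[OF Prec.IH(2)] computable
        semidecidable_decidable)
next
  case (Mu f)
  have eq: "eval (Mu f) (list_decode t) y \<longleftrightarrow>
    eval f (list_decode (Suc (prod_encode (y, t)))) 0 \<and>
    (\<forall>z<y. \<exists>v. v \<noteq> 0 \<and> eval f (list_decode (Suc (prod_encode (z, t)))) v)" for t y
    by (simp add: eval_Mu_iff)
  show ?case unfolding eq
    by (intro semidecidable_conj semidecidable_ex semidecidable_ball
        semidecidable_comp2[OF Mu.IH] computable semidecidable_decidable[OF decidable_not])
qed

lemma semidecidable_eval:
  assumes "computable a" "computable b"
  shows "semidecidable (\<lambda>x. eval r [a x] (b x))"
proof -
  have "semidecidable (\<lambda>x. eval r (list_decode (Suc (prod_encode (a x, 0)))) (b x))"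
    by (intro semidecidable_comp2[OF semidecidable_eval_decode] computable assms)
  then show ?thesis by simp
qed

lemma semidecidable_eval2:
  assumes "computable a" "computable b" "computable c"
  shows "semidecidable (\<lambda>x. eval r [a x, b x] (c x))"
proof -
  have "semidecidable (\<lambda>x. eval r (list_decode (Suc (prod_encode (a x, Suc (prod_encode (b x, 0)))))) (c x))"
    by (intro semidecidable_comp2[OF semidecidable_eval_decode] computable assms)
  then show ?thesis by simp
qed

section \<open>Partial computable functions with prescribed domains\<close>

lemma partial_computable_comp:
  assumes "partial_computable h" "computable f" shows "partial_computable (\<lambda>x. h (f x))"
proof -
  obtain r where r: "\<And>x y. h x = Some y \<longleftrightarrow> eval r [x] y"
    using assms(1) unfolding partial_computable_def by blast
  obtain q where "\<And>xs. length xs = 1 \<Longrightarrow> eval q xs (f (xs ! 0))"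
    using assms(2) unfolding computable_def computable_on_def by blast
  then have "eval q [x] (f x)" for x
    by (metis One_nat_def length_Cons list.size(3) nth_Cons_0)
  then have "eval q [x] y \<longleftrightarrow> y = f x" for x y
    using eval_det by blast
  then have "h (f x) = Some y \<longleftrightarrow> eval (Comp r [q]) [x] y" for x y
    by (simp add: r eval_Comp_iff list_all2_Cons1)
  then show ?thesis unfolding partial_computable_def by blast
qed

text \<open>The search for the first confirming stage halts exactly where \<open>P\<close> holds. It
  is a binary partial computable function, the form to which acceptability of a numbering
  applies.\<close>

lemma semidecidable_domain:
  assumes "semidecidable (\<lambda>z. P (pfst z) (psnd z))"
  shows "\<exists>\<psi>. partial_computable2 \<psi> \<and> (\<forall>x y. \<psi> x y \<noteq> None \<longleftrightarrow> P x y)"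
proof -
  obtain Q where Q: "decidable (\<lambda>z. Q (pfst z) (psnd z))"
    "\<And>z. P (pfst z) (psnd z) \<longleftrightarrow> (\<exists>t. Q t z)"
    using assms unfolding semidecidable_def by blast
  obtain r where r: "\<And>z v. eval r [z] v \<longleftrightarrow> Q v z \<and> (\<forall>t<v. \<not> Q t z)"
    using eval_search[OF Q(1)] by blast
  have "computable_on 2 (\<lambda>xs. prod_encode (xs ! 0, xs ! 1))"
    by (intro computable_on_pair computable_on_nth) auto
  then obtain q where q: "\<And>xs. length xs = 2 \<Longrightarrow> eval q xs (prod_encode (xs ! 0, xs ! 1))"
    by (auto simp: computable_on_def)
  have q': "eval q [x, y] v \<longleftrightarrow> v = prod_encode (x, y)" for x y v
    using q[of "[x, y]"] eval_det by auto
  define \<psi> where "\<psi> x y = (if P x y then Some (LEAST t. Q t (prod_encode (x, y))) else None)" for x y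
  have "\<psi> x y = Some v \<longleftrightarrow> eval (Comp r [q]) [x, y] v" for x y v
  proof -
    have "eval (Comp r [q]) [x, y] v \<longleftrightarrow>
        Q v (prod_encode (x, y)) \<and> (\<forall>t<v. \<not> Q t (prod_encode (x, y)))"
      by (auto simp: eval_Comp_iff list_all2_Cons1 q' r)
    also have "\<dots> \<longleftrightarrow> \<psi> x y = Some v"
      using Q(2)[of "prod_encode (x, y)"] unfolding \<psi>_def
      by (auto intro: LeastI dest: not_less_Least intro!: Least_equality simp flip: not_less)
    finally show ?thesis by simp
  qed
  then have "partial_computable2 \<psi>" unfolding partial_computable2_def by blast
  moreover have "\<psi> x y \<noteq> None \<longleftrightarrow> P x y" for x y by (simp add: \<psi>_def)
  ultimately show ?thesis by blast
qed

section \<open>Codes of finite sets and of prefixes of texts\<close>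

lemma decidable_set_decode [computable]:
  assumes "computable f" "computable g" shows "decidable (\<lambda>x. f x \<in> set_decode (g x))"
proof -
  have half: "computable (\<lambda>x. f x div 2)" if "computable f" for f
  proof -
    \<comment> \<open>\<open>k - k div 2\<close> equals \<open>Suc k div 2\<close>, so halving is a
      recursion that subtracts the previous value from the counter.\<close>
    have "computable (\<lambda>x. rec_nat 0 (\<lambda>k a. k - a) (f x))"
      by (intro computable_rec[where g = "\<lambda>k a x. k - a"] computable that)
    moreover have "rec_nat 0 (\<lambda>k a. k - a) n = n div 2" for n :: nat
      by (induction n) auto
    ultimately show ?thesis by simp
  qed
  have "((\<lambda>m. m div 2) ^^ n) m = m div 2 ^ n" for m n :: nat
    by (induction n) (simp_all add: mult.commute flip: div_mult2_eq)
  then have "computable (\<lambda>x. g x div 2 ^ f x)"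
    using computable_funpow[OF half[OF computable_id] assms] by simp
  then have "decidable (\<lambda>x. \<not> (g x div 2 ^ f x div 2) + (g x div 2 ^ f x div 2) = g x div 2 ^ f x)"
    by (intro computable half)
  moreover have "odd n \<longleftrightarrow> n div 2 + n div 2 \<noteq> n" for n :: nat by presburger
  ultimately show ?thesis by (simp add: set_decode_def)
qed

lemma less_of_mem_set_decode: "x \<in> set_decode d \<Longrightarrow> x < d"
proof (rule ccontr)
  assume "x \<in> set_decode d" "\<not> x < d"
  then have "d < 2 ^ x" by (meson less_exp less_le_trans not_less le_less_trans)
  with \<open>x \<in> set_decode d\<close> show False by (simp add: set_decode_def)
qed

definition decode_seq :: "nat \<Rightarrow> nat option list" where
  "decode_seq s = map (\<lambda>v. case v of 0 \<Rightarrow> None | Suc x \<Rightarrow> Some x) (list_decode s)"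

lemma decode_code_seq [simp]: "decode_seq (code_seq xs) = xs"
  by (auto simp: decode_seq_def code_seq_def o_def split: option.split intro!: map_idI)

lemma code_decode_seq [simp]: "code_seq (decode_seq s) = s"
proof -
  have "map (\<lambda>v. case v of None \<Rightarrow> 0 | Some x \<Rightarrow> Suc x) (decode_seq s) = list_decode s"
    by (auto simp: decode_seq_def o_def split: nat.split intro!: map_idI)
  then show ?thesis by (simp add: code_seq_def)
qed

lemma length_decode_seq [simp]: "length (decode_seq s) = length (list_decode s)"
  by (simp add: decode_seq_def)

lemma finite_content_list [simp]: "finite (content_list xs)"
proof -
  have "content_list xs = the ` (set xs - {None})"
    by (force simp: content_list_def image_iff)
  then show ?thesis by simp
qed

text \<open>The default 0 of \<open>code_nth\<close> is never a successor, so letting the index run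
  up to \<open>s\<close>, possibly beyond the length, adds no elements.\<close>

lemma mem_content_decode_seq: "x \<in> content_list (decode_seq s) \<longleftrightarrow> (\<exists>i<s. code_nth s i = Suc x)"
proof -
  have "Some x = (case v of 0 \<Rightarrow> None | Suc y \<Rightarrow> Some y) \<longleftrightarrow> v = Suc x" for v
    by (cases v) auto
  then have "x \<in> content_list (decode_seq s) \<longleftrightarrow> Suc x \<in> set (list_decode s)"
    by (simp add: content_list_def decode_seq_def image_iff)
  also have "\<dots> \<longleftrightarrow> (\<exists>i<s. code_nth s i = Suc x)"
    unfolding in_set_conv_nth code_nth_eq using length_list_decode_le[of s]
    by (metis less_le_trans nat.distinct(1))
  finally show ?thesis .
qed

lemma less_of_mem_content: "x \<in> content_list (decode_seq s) \<Longrightarrow> x < s"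
  by (metis Suc_le_eq code_nth_le mem_content_decode_seq)

lemma decidable_content [computable]:
  assumes "computable f" "computable g" shows "decidable (\<lambda>x. f x \<in> content_list (decode_seq (g x)))"
  unfolding mem_content_decode_seq
  by (intro computable computable_comp[OF assms(1)] computable_comp[OF assms(2)])

definition seq_extends :: "nat \<Rightarrow> nat \<Rightarrow> bool" where
  "seq_extends s t \<longleftrightarrow> (\<exists>\<rho>. decode_seq t = decode_seq s @ \<rho>)"

text \<open>A nonzero iterated tail expresses that position \<open>i\<close> exists, so the prefix
  relation becomes a bounded quantifier over decidable conditions.\<close>

lemma seq_extends_iff: "seq_extends s t \<longleftrightarrow>
  (\<forall>i<s. (code_tl ^^ i) s \<noteq> 0 \<longrightarrow> (code_tl ^^ i) t \<noteq> 0 \<and> code_nth s i = code_nth t i)"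
proof -
  let ?f = "\<lambda>v. case v of 0 \<Rightarrow> None | Suc x \<Rightarrow> Some x" let ?a = "list_decode s" let ?b = "list_decode t"
  have "inj ?f" by (auto simp: inj_def split: nat.splits)
  have "seq_extends s t \<longleftrightarrow> take (length ?a) (decode_seq t) = decode_seq s"
    unfolding seq_extends_def by (metis append_eq_conv_conj append_take_drop_id length_decode_seq)
  also have "\<dots> \<longleftrightarrow> take (length ?a) ?b = ?a"
    unfolding decode_seq_def take_map using \<open>inj ?f\<close> by (simp add: inj_map_eq_map)
  also have "\<dots> \<longleftrightarrow> (\<forall>i<length ?a. i < length ?b \<and> ?a ! i = ?b ! i)"
  proof
    assume "take (length ?a) ?b = ?a"
    then show "\<forall>i<length ?a. i < length ?b \<and> ?a ! i = ?b ! i"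
      by (metis length_take min_less_iff_conj nth_take)
  next
    assume *: "\<forall>i<length ?a. i < length ?b \<and> ?a ! i = ?b ! i"
    then have "length ?a \<le> length ?b" by (meson leI less_irrefl)
    with * show "take (length ?a) ?b = ?a" by (intro nth_equalityI) auto
  qed
  also have "\<dots> \<longleftrightarrow> (\<forall>i<s. (code_tl ^^ i) s \<noteq> 0 \<longrightarrow> (code_tl ^^ i) t \<noteq> 0 \<and> code_nth s i = code_nth t i)"
    unfolding funpow_code_tl_eq_0 code_nth_eq using length_list_decode_le[of s]
    by (meson not_le less_le_trans)
  finally show ?thesis .
qed

lemma decidable_seq_extends [computable]:
  assumes "computable f" "computable g" shows "decidable (\<lambda>x. seq_extends (f x) (g x))"
  unfolding seq_extends_iff
  by (intro computable computable_comp[OF assms(1)] computable_comp[OF assms(2)])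

lemma computable_length_decode: "computable (\<lambda>s. length (list_decode s))"
proof -
  have "computable (\<lambda>s. LEAST n. (code_tl ^^ n) s = 0)"
    by (intro computable_Least computable) (auto simp: funpow_code_tl_eq_0)
  moreover have "(LEAST n. (code_tl ^^ n) s = 0) = length (list_decode s)" for s
    by (rule Least_equality) (auto simp: funpow_code_tl_eq_0)
  ultimately show ?thesis by simp
qed

lemma computable_set_encode_content:
  "computable (\<lambda>s. set_encode (content_list (decode_seq s)))"
proof -
  \<comment> \<open>The bound \<open>d + s\<close> exceeds all elements of both sets, so
    \<open>P\<close> decides their equality and the canonical index is found by search.\<close>
  define P where "P d s \<longleftrightarrow> (\<forall>x<d + s. (x \<in> set_decode d \<longrightarrow> x \<in> content_list (decode_seq s)) \<and>
    (x \<in> content_list (decode_seq s) \<longrightarrow> x \<in> set_decode d))" for d s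
  have P: "P d s \<longleftrightarrow> d = set_encode (content_list (decode_seq s))" for d s
  proof -
    have "P d s \<longleftrightarrow> set_decode d = content_list (decode_seq s)"
      unfolding P_def set_eq_iff
      by (meson less_of_mem_set_decode less_of_mem_content trans_less_add1 trans_less_add2)
    then show ?thesis
      by (metis finite_content_list set_decode_inverse set_encode_inverse)
  qed
  have "computable (\<lambda>s. LEAST d. P d s)"
  proof (rule computable_Least)
    show "decidable (\<lambda>z. P (pfst z) (psnd z))"
      unfolding P_def by (intro computable)
  qed (simp add: P)
  then show ?thesis by (simp add: P Least_equality)
qed

section \<open>From sequences to sets\<close>

lemma prefix_append:
  "prefix (\<lambda>i. if i < length \<sigma> then \<sigma> ! i else T (i - length \<sigma>)) (length \<sigma> + n) = \<sigma> @ prefix T n"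
  by (rule nth_equalityI) (auto simp: prefix_def nth_append)

lemma content_list_append [simp]: "content_list (\<sigma> @ \<rho>) = content_list \<sigma> \<union> content_list \<rho>"
  by (auto simp: content_list_def)

lemma content_list_prefix: "content_list (prefix T n) = {x. \<exists>i<n. T i = Some x}"
  by (force simp: content_list_def prefix_def image_iff)

section \<open>Conjectured languages, abstracted from their indices, and their hulls\<close>

locale conservative =
  fixes A :: "nat option list \<Rightarrow> nat set"
  assumes conservative: "content_list (\<sigma> @ \<rho>) \<subseteq> A \<sigma> \<Longrightarrow> A (\<sigma> @ \<rho>) = A \<sigma>"
begin

inductive_set hull :: "nat option list \<Rightarrow> nat set \<Rightarrow> nat set" for \<sigma> D where
  base: "x \<in> D \<Longrightarrow> x \<in> hull \<sigma> D"
| step: "\<forall>y \<in> content_list (\<sigma> @ \<rho>). y \<in> hull \<sigma> D \<Longrightarrow> x \<in> A (\<sigma> @ \<rho>) \<Longrightarrow> x \<in> hull \<sigma> D"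

lemma hull_least:
  assumes "D \<subseteq> X" "\<And>\<rho>. content_list (\<sigma> @ \<rho>) \<subseteq> X \<Longrightarrow> A (\<sigma> @ \<rho>) \<subseteq> X"
  shows "hull \<sigma> D \<subseteq> X"
proof
  show "x \<in> X" if "x \<in> hull \<sigma> D" for x
    using that by induction (use assms in blast)+
qed

lemma hull_closed: "content_list (\<sigma> @ \<rho>) \<subseteq> hull \<sigma> D \<Longrightarrow> A (\<sigma> @ \<rho>) \<subseteq> hull \<sigma> D"
  using hull.step by blast

text \<open>By conservativeness \<open>A \<sigma>\<close> is itself closed: an extension of
  \<open>\<sigma>\<close> with content inside \<open>A \<sigma>\<close> has the same
  conjecture.\<close>

lemma hull_subset: "D \<subseteq> A \<sigma> \<Longrightarrow> hull \<sigma> D \<subseteq> A \<sigma>"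
  by (rule hull_least) (auto simp: conservative)

text \<open>\<open>hull \<sigma>\<close> is a closure operator, so enlarging \<open>D\<close> within
  its own closure changes nothing.\<close>

lemma hull_eq:
  assumes "D \<subseteq> D'" "D' \<subseteq> hull \<sigma> D" shows "hull \<sigma> D' = hull \<sigma> D"
proof
  show "hull \<sigma> D' \<subseteq> hull \<sigma> D"
    using assms(2) hull_closed by (rule hull_least)
  show "hull \<sigma> D \<subseteq> hull \<sigma> D'"
    using assms(1) hull.base hull_closed by (intro hull_least) blast+
qed

definition candidate :: "nat option list \<Rightarrow> nat set \<Rightarrow> bool" where
  "candidate \<sigma> D \<longleftrightarrow> content_list \<sigma> \<subseteq> D \<and> D \<subseteq> A \<sigma>"

definition restricted_hull :: "nat option list \<Rightarrow> nat set \<Rightarrow> nat set" where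
  "restricted_hull \<sigma> D = {x. (x \<in> D \<or> code_seq \<sigma> \<le> x) \<and>
     (\<forall>\<sigma>'. code_seq \<sigma>' \<le> code_seq \<sigma> \<longrightarrow> content_list \<sigma>' \<subseteq> D \<longrightarrow> x \<in> hull \<sigma>' D)}"

definition conjecture :: "nat set \<Rightarrow> nat set" where
  "conjecture D = (\<Union>\<sigma>\<in>{\<sigma>. candidate \<sigma> D}. restricted_hull \<sigma> D)"

definition least_candidate :: "nat option list \<Rightarrow> nat set \<Rightarrow> bool" where
  "least_candidate \<sigma> D \<longleftrightarrow> candidate \<sigma> D \<and> (\<forall>\<sigma>'. candidate \<sigma>' D \<longrightarrow> code_seq \<sigma> \<le> code_seq \<sigma>')"

lemma ex_least_candidate: "candidate \<sigma> D \<Longrightarrow> \<exists>\<sigma>. least_candidate \<sigma> D"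
  unfolding least_candidate_def by (rule ex_has_least_nat)

text \<open>Both conditions in \<open>restricted_hull\<close> get stronger as the code of
  \<open>\<sigma>\<close> grows, so every other candidate contributes a subset. The union can thus
  be enumerated without knowing which candidate is least.\<close>

lemma conjecture_eq: "least_candidate \<sigma> D \<Longrightarrow> conjecture D = restricted_hull \<sigma> D"
  unfolding conjecture_def least_candidate_def restricted_hull_def
  by (auto; meson order_trans)

lemma less_code_seq: "x \<in> content_list \<sigma> \<Longrightarrow> x < code_seq \<sigma>"
  using less_of_mem_content[of x "code_seq \<sigma>"] by simp

lemma conjecture_conservative:
  assumes "D \<subseteq> D'" "D' \<subseteq> conjecture D" shows "conjecture D' = conjecture D"
proof (cases "\<exists>\<sigma>. candidate \<sigma> D")
  case False
  \<comment> \<open>Without a candidate the proposal is empty, which forces both sets to be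
    empty.\<close>
  then have "conjecture D = {}" by (auto simp: conjecture_def)
  with assms have "D' = D" by simp
  then show ?thesis by simp
next
  case True
  then obtain \<sigma> where \<sigma>: "least_candidate \<sigma> D" using ex_least_candidate by blast
  then have cand: "content_list \<sigma> \<subseteq> D" "D \<subseteq> A \<sigma>" by (auto simp: least_candidate_def candidate_def)
  have eq: "conjecture D = restricted_hull \<sigma> D" using \<sigma> by (rule conjecture_eq)
  \<comment> \<open>Elements of \<open>D'\<close> satisfy the size condition, so none below the code
    of \<open>\<sigma>\<close> is new. As a code exceeds all elements of its sequence, no further
    sequence up to \<open>\<sigma>\<close> acquires its content inside \<open>D'\<close>.\<close>
  have small: "x \<in> D" if "x \<in> D'" "x < code_seq \<sigma>" for x
    using that assms(2) unfolding eq by (auto simp: restricted_hull_def)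
  have content: "content_list \<sigma>' \<subseteq> D' \<longleftrightarrow> content_list \<sigma>' \<subseteq> D" if "code_seq \<sigma>' \<le> code_seq \<sigma>" for \<sigma>'
    using small assms(1) that less_code_seq[of _ \<sigma>'] by (meson less_le_trans subset_eq)
  have hull: "D' \<subseteq> hull \<sigma>' D" if "code_seq \<sigma>' \<le> code_seq \<sigma>" "content_list \<sigma>' \<subseteq> D" for \<sigma>'
    using that assms(2) unfolding eq by (auto simp: restricted_hull_def)
  \<comment> \<open>\<open>\<sigma>\<close> itself is among the sequences whose hull contains
    \<open>D'\<close>, and this hull stays inside \<open>A \<sigma>\<close>.\<close>
  have "D' \<subseteq> A \<sigma>"
    using hull[of \<sigma>] cand hull_subset[of D \<sigma>] by blast
  with cand assms(1) have "candidate \<sigma> D'" by (auto simp: candidate_def)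
  moreover have "code_seq \<sigma> \<le> code_seq \<sigma>'" if "candidate \<sigma>' D'" for \<sigma>'
  proof (rule ccontr)
    assume less: "\<not> code_seq \<sigma> \<le> code_seq \<sigma>'"
    \<comment> \<open>By \<open>content\<close> the elements of \<open>\<sigma>'\<close> already lie
      in \<open>D\<close>, and \<open>D\<close> is below \<open>D'\<close>, hence inside
      \<open>A \<sigma>'\<close>.\<close>
    then have "candidate \<sigma>' D" using that content[of \<sigma>'] assms(1) by (auto simp: candidate_def)
    with less \<sigma> show False by (auto simp: least_candidate_def)
  qed
  ultimately have "conjecture D' = restricted_hull \<sigma> D'"
    by (intro conjecture_eq) (auto simp: least_candidate_def)
  also have "\<dots> = restricted_hull \<sigma> D"
  proof -
    have "hull \<sigma>' D' = hull \<sigma>' D" if "code_seq \<sigma>' \<le> code_seq \<sigma>" "content_list \<sigma>' \<subseteq> D" for \<sigma>'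
      using assms(1) hull[OF that] by (rule hull_eq)
    moreover have "x \<in> D' \<or> code_seq \<sigma> \<le> x \<longleftrightarrow> x \<in> D \<or> code_seq \<sigma> \<le> x" for x
      using assms(1) small[of x] by (auto simp: not_le)
    ultimately show ?thesis
      unfolding restricted_hull_def using content by (intro Collect_cong) metis
  qed
  finally show ?thesis by (simp add: eq)
qed

section \<open>Convergence on a language that the given learner identifies\<close>

context
  fixes L :: "nat set"
  assumes learned: "\<And>T. content T = L \<Longrightarrow> \<exists>n0. \<forall>n\<ge>n0. A (prefix T n) = L"
begin

text \<open>The learner is fed \<open>\<sigma>\<close> and then each \<open>x\<close> in
  \<open>L\<close> at offset \<open>x\<close>, with pauses elsewhere. It converges to
  \<open>L\<close> on this text, so some prefix extending \<open>\<sigma>\<close> yields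
  \<open>L\<close>.\<close>

lemma ex_extension:
  assumes "content_list \<sigma> \<subseteq> L" shows "\<exists>\<rho>. content_list \<rho> \<subseteq> L \<and> A (\<sigma> @ \<rho>) = L"
proof -
  let ?T = "\<lambda>x. if x \<in> L then Some x else None"
  let ?S = "\<lambda>i. if i < length \<sigma> then \<sigma> ! i else ?T (i - length \<sigma>)"
  have "content ?S = L"
  proof
    show "content ?S \<subseteq> L"
    proof
      fix x assume "x \<in> content ?S"
      then obtain i where i: "?S i = Some x" by (auto simp: content_def)
      show "x \<in> L"
      proof (cases "i < length \<sigma>")
        case True
        with i have "x \<in> content_list \<sigma>"
          using nth_mem[OF True] by (simp add: content_list_def)
        with assms show ?thesis by blast
      qed (use i in \<open>simp split: if_splits\<close>)
    qed
    show "L \<subseteq> content ?S"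
      unfolding content_def by (auto intro!: exI[of _ "length \<sigma> + _"])
  qed
  then obtain n0 where "\<forall>n\<ge>n0. A (prefix ?S n) = L"
    using learned by blast
  then have "A (prefix ?S (length \<sigma> + n0)) = L" by simp
  then have "A (\<sigma> @ prefix ?T n0) = L" using prefix_append[of \<sigma> ?T n0] by simp
  moreover have "content_list (prefix ?T n0) \<subseteq> L" by (auto simp: content_list_prefix split: if_splits)
  ultimately show ?thesis by blast
qed

text \<open>\<open>D\<^sub>0\<close> acts as a tell-tale: a text for \<open>L\<close> lists it after
  finitely many steps, and from then on the content stays between \<open>D\<^sub>0\<close> and
  \<open>L\<close>.\<close>

lemma conjecture_learns:
  "\<exists>D\<^sub>0. finite D\<^sub>0 \<and> D\<^sub>0 \<subseteq> L \<and> (\<forall>D. D\<^sub>0 \<subseteq> D \<longrightarrow> D \<subseteq> L \<longrightarrow> conjecture D = L)"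
proof -
  define good where "good \<sigma> \<longleftrightarrow> content_list \<sigma> \<subseteq> L \<and> A \<sigma> = L" for \<sigma>
  have "\<exists>\<sigma>. good \<sigma>"
    using ex_extension[of "[]"] by (auto simp: good_def content_list_def)
  then obtain \<sigma> where \<sigma>: "good \<sigma>" "\<And>\<sigma>'. good \<sigma>' \<Longrightarrow> code_seq \<sigma> \<le> code_seq \<sigma>'"
    using ex_has_least_nat[of good _ code_seq] by blast
  obtain \<tau> where \<tau>: "\<And>\<sigma>'. content_list \<sigma>' \<subseteq> L \<Longrightarrow> content_list (\<tau> \<sigma>') \<subseteq> L \<and> A (\<sigma>' @ \<tau> \<sigma>') = L"
    using ex_extension by metis
  \<comment> \<open>The extension by \<open>\<tau> \<sigma>'\<close> has content in
    \<open>L\<close>, hence in \<open>A \<sigma>'\<close>, so conservativeness gives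
    \<open>A \<sigma>' = L\<close>. By minimality of \<open>\<sigma>\<close>, every sequence over
    \<open>L\<close> with smaller code must then miss an element of \<open>L\<close>, chosen below
    as \<open>w \<sigma>'\<close>.\<close>
  have good: "good \<sigma>'" if "content_list \<sigma>' \<subseteq> L" "L \<subseteq> A \<sigma>'" for \<sigma>'
    using \<tau>[OF that(1)] that conservative[of \<sigma>' "\<tau> \<sigma>'"] by (auto simp: good_def)
  then have "\<exists>w. w \<in> L - A \<sigma>'" if "content_list \<sigma>' \<subseteq> L" "code_seq \<sigma>' < code_seq \<sigma>" for \<sigma>'
    using that \<sigma>(2)[of \<sigma>'] by fastforce
  then obtain w where w:
    "\<And>\<sigma>'. content_list \<sigma>' \<subseteq> L \<Longrightarrow> code_seq \<sigma>' < code_seq \<sigma> \<Longrightarrow> w \<sigma>' \<in> L - A \<sigma>'"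
    by metis
  define S where "S = {\<sigma>'. content_list \<sigma>' \<subseteq> L \<and> code_seq \<sigma>' \<le> code_seq \<sigma>}"
  have "S \<subseteq> decode_seq ` {..code_seq \<sigma>}"
    unfolding S_def by (auto intro!: image_eqI[of _ _ "code_seq _"])
  then have "finite S" by (rule finite_subset) simp
  \<comment> \<open>The first part settles the size condition and contains the content of
    \<open>\<sigma>\<close>, the second makes the relevant hulls contain \<open>L\<close>, and the
    third rules out smaller candidates.\<close>
  define D\<^sub>0 where "D\<^sub>0 = {x \<in> L. x < code_seq \<sigma>} \<union> (\<Union>\<sigma>'\<in>S. content_list (\<tau> \<sigma>')) \<union>
    w ` {\<sigma>' \<in> S. code_seq \<sigma>' < code_seq \<sigma>}"
  have "finite D\<^sub>0" using \<open>finite S\<close> by (simp add: D\<^sub>0_def)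
  moreover have "D\<^sub>0 \<subseteq> L" using \<tau> w by (auto simp: D\<^sub>0_def S_def)
  moreover have "conjecture D = L" if D: "D\<^sub>0 \<subseteq> D" "D \<subseteq> L" for D
  proof -
    have A: "A \<sigma> = L" and \<sigma>L: "content_list \<sigma> \<subseteq> L" using \<sigma>(1) by (auto simp: good_def)
    have \<sigma>D: "content_list \<sigma> \<subseteq> D"
      using \<sigma>L D(1) less_code_seq by (auto simp: D\<^sub>0_def)
    have "candidate \<sigma> D" using \<sigma>D A D(2) by (simp add: candidate_def)
    moreover have "code_seq \<sigma> \<le> code_seq \<sigma>'" if "candidate \<sigma>' D" for \<sigma>'
    proof (rule ccontr)
      assume less: "\<not> code_seq \<sigma> \<le> code_seq \<sigma>'"
      have "content_list \<sigma>' \<subseteq> L" "D \<subseteq> A \<sigma>'" using that D(2) by (auto simp: candidate_def)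
      with less have "w \<sigma>' \<in> D\<^sub>0" "w \<sigma>' \<notin> A \<sigma>'" using w[of \<sigma>'] by (auto simp: D\<^sub>0_def S_def)
      with \<open>D \<subseteq> A \<sigma>'\<close> D(1) show False by blast
    qed
    ultimately have "conjecture D = restricted_hull \<sigma> D"
      by (intro conjecture_eq) (simp add: least_candidate_def)
    also have "\<dots> = L"
    proof
      show "restricted_hull \<sigma> D \<subseteq> L"
        using hull_subset[of D \<sigma>] A D(2) \<sigma>D by (auto simp: restricted_hull_def)
      \<comment> \<open>\<open>D\<close> contains the content of
        \<open>\<sigma>' @ \<tau> \<sigma>'\<close>, so a single closure step adds its conjecture,
        which is \<open>L\<close>.\<close>
      have "L \<subseteq> hull \<sigma>' D" if "code_seq \<sigma>' \<le> code_seq \<sigma>" "content_list \<sigma>' \<subseteq> D" for \<sigma>'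
      proof -
        have "\<sigma>' \<in> S" using that D(2) by (auto simp: S_def)
        then have "content_list (\<sigma>' @ \<tau> \<sigma>') \<subseteq> D" using that(2) D(1) by (auto simp: D\<^sub>0_def)
        then have "A (\<sigma>' @ \<tau> \<sigma>') \<subseteq> hull \<sigma>' D" using hull.base by (intro hull_closed) blast
        then show ?thesis using \<tau>[of \<sigma>'] \<open>\<sigma>' \<in> S\<close> by (simp add: S_def)
      qed
      moreover have "x \<in> D \<or> code_seq \<sigma> \<le> x" if "x \<in> L" for x
        using that D(1) by (auto simp: D\<^sub>0_def not_le)
      ultimately show "L \<subseteq> restricted_hull \<sigma> D"
        by (auto simp: restricted_hull_def)
    qed
    finally show ?thesis .
  qed
  ultimately show ?thesis by blast
qed

end

section \<open>Enumerability of the hulls and of the new conjectures\<close>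

definition derivation :: "nat option list \<Rightarrow> nat set \<Rightarrow> nat list \<Rightarrow> bool" where
  "derivation \<sigma> D xs \<longleftrightarrow> (\<forall>i<length xs. xs ! i \<in> D \<or>
     (\<exists>\<rho>. content_list (\<sigma> @ \<rho>) \<subseteq> set (take i xs) \<and> xs ! i \<in> A (\<sigma> @ \<rho>)))"

lemma derivation_append:
  assumes "derivation \<sigma> D xs" "derivation \<sigma> D ys" shows "derivation \<sigma> D (xs @ ys)"
  unfolding derivation_def
proof (intro allI impI)
  fix i assume i: "i < length (xs @ ys)"
  show "(xs @ ys) ! i \<in> D \<or> (\<exists>\<rho>. content_list (\<sigma> @ \<rho>) \<subseteq> set (take i (xs @ ys)) \<and> (xs @ ys) ! i \<in> A (\<sigma> @ \<rho>))"
  proof (cases "i < length xs")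
    case True
    then show ?thesis using assms(1) by (simp add: derivation_def nth_append)
  next
    case False
    then obtain k where k: "i = length xs + k" by (metis le_iff_add not_less)
    with i have "k < length ys" by simp
    with assms(2) have "ys ! k \<in> D \<or>
        (\<exists>\<rho>. content_list (\<sigma> @ \<rho>) \<subseteq> set (take k ys) \<and> ys ! k \<in> A (\<sigma> @ \<rho>))"
      by (simp only: derivation_def)
    then show ?thesis unfolding k nth_append_length_plus by (auto; blast)
  qed
qed

text \<open>Each closure step depends on the finitely many elements of a sequence, so membership in
  the hull has a finite certificate, listed in order like a formal proof.\<close>

lemma mem_hull_iff: "x \<in> hull \<sigma> D \<longleftrightarrow> (\<exists>xs. derivation \<sigma> D xs \<and> x \<in> set xs)"
proof
  assume "x \<in> hull \<sigma> D"
  then show "\<exists>xs. derivation \<sigma> D xs \<and> x \<in> set xs"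
  proof induction
    case (base x)
    then show ?case by (intro exI[of _ "[x]"]) (simp add: derivation_def)
  next
    case (step \<rho> x)
    \<comment> \<open>The derivations of the finitely many elements of the content are concatenated
      one at a time.\<close>
    have "\<exists>xs. derivation \<sigma> D xs \<and> Y \<subseteq> set xs" if "finite Y" "Y \<subseteq> content_list (\<sigma> @ \<rho>)" for Y
      using that
    proof induction
      case empty
      show ?case by (rule exI[of _ "[]"]) (simp add: derivation_def)
    next
      case (insert y Y)
      then obtain xs ys where "derivation \<sigma> D xs" "Y \<subseteq> set xs" "derivation \<sigma> D ys" "y \<in> set ys"
        using step.IH by blast
      then show ?case by (intro exI[of _ "xs @ ys"]) (auto intro: derivation_append)
    qed
    from this[of "content_list (\<sigma> @ \<rho>)"] obtain xs
      where xs: "derivation \<sigma> D xs" "content_list (\<sigma> @ \<rho>) \<subseteq> set xs"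
      using finite_content_list by blast
    have "derivation \<sigma> D (xs @ [x])"
      unfolding derivation_def
    proof (intro allI impI)
      fix i assume "i < length (xs @ [x])"
      then consider "i < length xs" | "i = length xs" by force
      then show "(xs @ [x]) ! i \<in> D \<or> (\<exists>\<rho>. content_list (\<sigma> @ \<rho>) \<subseteq> set (take i (xs @ [x])) \<and>
          (xs @ [x]) ! i \<in> A (\<sigma> @ \<rho>))"
      proof cases
        case 1
        then show ?thesis using xs(1) by (simp add: derivation_def nth_append)
      next
        case 2
        then show ?thesis using xs(2) step.hyps by auto
      qed
    qed
    then show ?case by (intro exI[of _ "xs @ [x]"]) simp
  qed
next
  assume "\<exists>xs. derivation \<sigma> D xs \<and> x \<in> set xs"
  then obtain xs i where xs: "derivation \<sigma> D xs" "i < length xs" "x = xs ! i"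
    by (auto simp: in_set_conv_nth)
  have "xs ! i \<in> hull \<sigma> D" using xs(2)
  proof (induction i rule: less_induct)
    case (less i)
    then have *: "set (take i xs) \<subseteq> hull \<sigma> D" by (auto simp: in_set_conv_nth)
    from xs(1) less.prems have "xs ! i \<in> D \<or>
        (\<exists>\<rho>. content_list (\<sigma> @ \<rho>) \<subseteq> set (take i xs) \<and> xs ! i \<in> A (\<sigma> @ \<rho>))"
      by (auto simp: derivation_def)
    then show ?case using * hull_closed hull.base by blast
  qed
  then show "x \<in> hull \<sigma> D" using xs(3) by simp
qed

text \<open>A derivation is represented by its length \<open>n\<close> and a code \<open>l\<close>
  of which only the first \<open>n\<close> entries matter. The remaining quantifiers are bounded or
  existential, as the closure properties of \<open>semidecidable\<close> require.\<close>

lemma mem_hull_code_iff: "x \<in> hull (decode_seq s) D \<longleftrightarrow>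
  (\<exists>l n. (\<forall>i<n. code_nth l i \<in> D \<or> (\<exists>t. seq_extends s t \<and>
      (\<forall>y<t. y \<in> content_list (decode_seq t) \<longrightarrow> (\<exists>j<i. code_nth l j = y)) \<and>
      code_nth l i \<in> A (decode_seq t))) \<and> (\<exists>i<n. code_nth l i = x))" (is "_ \<longleftrightarrow> (\<exists>l n. ?P l n)")
proof -
  have ext: "(\<exists>t. seq_extends s t \<and> content_list (decode_seq t) \<subseteq> X \<and> y \<in> A (decode_seq t)) \<longleftrightarrow>
      (\<exists>\<rho>. content_list (decode_seq s @ \<rho>) \<subseteq> X \<and> y \<in> A (decode_seq s @ \<rho>))" for X y
    unfolding seq_extends_def by (metis decode_code_seq)
  have content: "(\<forall>y<t. y \<in> content_list (decode_seq t) \<longrightarrow> y \<in> X) \<longleftrightarrow> content_list (decode_seq t) \<subseteq> X" for t X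
    using less_of_mem_content by blast
  have P: "?P l n \<longleftrightarrow> derivation (decode_seq s) D xs \<and> x \<in> set xs"
    if xs: "n = length xs" "\<forall>i<n. code_nth l i = xs ! i" for l n xs
  proof -
    have "(\<exists>j<i. code_nth l j = y) \<longleftrightarrow> y \<in> set (take i xs)" if "i < n" for i y
      using xs that by (auto simp: in_set_conv_nth)
    then have "?P l n \<longleftrightarrow> (\<forall>i<n. xs ! i \<in> D \<or> (\<exists>t. seq_extends s t \<and>
      content_list (decode_seq t) \<subseteq> set (take i xs) \<and> xs ! i \<in> A (decode_seq t))) \<and> (\<exists>i<n. xs ! i = x)"
      using xs(2) by (simp add: content cong: conj_cong)
    also have "\<dots> \<longleftrightarrow> derivation (decode_seq s) D xs \<and> x \<in> set xs"
      unfolding ext derivation_def in_set_conv_nth xs(1) by simp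
    finally show ?thesis .
  qed
  show ?thesis unfolding mem_hull_iff
  proof
    assume "\<exists>xs. derivation (decode_seq s) D xs \<and> x \<in> set xs"
    then obtain xs where xs: "derivation (decode_seq s) D xs \<and> x \<in> set xs" by blast
    obtain l where "\<forall>i<length xs. code_nth l i = xs ! i" using ex_code_nth by blast
    with xs show "\<exists>l n. ?P l n" using P[OF refl] by blast
  next
    assume "\<exists>l n. ?P l n"
    then obtain l n where "?P l n" by blast
    then show "\<exists>xs. derivation (decode_seq s) D xs \<and> x \<in> set xs"
      using P[of n "map (code_nth l) [0..<n]" l] by auto
  qed
qed

text \<open>The universal quantifiers over \<open>D\<close>, over contents and over sequences up to
  \<open>\<sigma>\<close> are bounded by codes, and the choice of a candidate is existential. The
  premises of implications are decidable.\<close>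

lemma semidecidable_conjecture:
  assumes A: "semidecidable (\<lambda>z. psnd z \<in> A (decode_seq (pfst z)))"
  shows "semidecidable (\<lambda>z. psnd z \<in> conjecture (set_decode (pfst z)))"
proof -
  have A': "semidecidable (\<lambda>z. f z \<in> A (decode_seq (g z)))" if "computable f" "computable g" for f g
    using semidecidable_comp2[of "\<lambda>s x. x \<in> A (decode_seq s)", OF A that(2,1)] .
  have hull: "semidecidable (\<lambda>z. f z \<in> hull (decode_seq (g z)) (set_decode (d z)))"
    if fgd: "computable f" "computable g" "computable d" for f g d
    unfolding mem_hull_code_iff
    by (intro semidecidable_ex semidecidable_conj semidecidable_ball semidecidable_disj A'
        semidecidable_decidable computable computable_comp[OF fgd(1)] computable_comp[OF fgd(2)]
        computable_comp[OF fgd(3)])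
  have sub: "content_list (decode_seq s) \<subseteq> D \<longleftrightarrow> (\<forall>x<s. x \<in> content_list (decode_seq s) \<longrightarrow> x \<in> D)" for s D
    using less_of_mem_content by blast
  have sup: "set_decode d \<subseteq> X \<longleftrightarrow> (\<forall>x<d. x \<in> set_decode d \<longrightarrow> x \<in> X)" for d X
    using less_of_mem_set_decode by blast
  have all: "(\<forall>\<sigma>'. code_seq \<sigma>' \<le> s \<longrightarrow> P \<sigma>') \<longleftrightarrow> (\<forall>t<Suc s. P (decode_seq t))" for s P
    by (metis code_decode_seq decode_code_seq less_Suc_eq_le)
  have ex: "(\<exists>\<sigma>. P \<sigma>) \<longleftrightarrow> (\<exists>s. P (decode_seq s))" for P
    by (metis decode_code_seq)
  have eq: "x \<in> conjecture D \<longleftrightarrow> (\<exists>s. content_list (decode_seq s) \<subseteq> D \<and> D \<subseteq> A (decode_seq s) \<and>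
      (x \<in> D \<or> s \<le> x) \<and> (\<forall>t<Suc s. content_list (decode_seq t) \<subseteq> D \<longrightarrow> x \<in> hull (decode_seq t) D))" for x D
    unfolding conjecture_def candidate_def restricted_hull_def all
    by (simp add: ex[of "\<lambda>\<sigma>. _ \<sigma> \<and> _ \<sigma>"])
  show ?thesis unfolding eq sub sup
    by (intro semidecidable_ex semidecidable_conj semidecidable_ball semidecidable_imp hull A'
        semidecidable_decidable[OF decidable_disj] semidecidable_decidable[OF decidable_ball]
        semidecidable_decidable[OF decidable_set_decode] computable)
qed

end

section \<open>The inclusions between the learnable classes\<close>

lemma learnable_classes_mono:
  assumes "\<And>h. partial_computable h \<Longrightarrow>
    \<exists>h'. partial_computable h' \<and> (\<forall>T i. interact \<beta>' h' T i = interact \<beta> h T i)"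
  shows "learnable_classes \<phi> \<beta> \<subseteq> learnable_classes \<phi> \<beta>'"
proof
  fix \<L> assume "\<L> \<in> learnable_classes \<phi> \<beta>"
  then obtain h where h: "partial_computable h" "\<forall>L\<in>\<L>. learns \<phi> \<beta> h L"
    by (auto simp: learnable_classes_def)
  from assms[OF h(1)] obtain h' where "partial_computable h'" "\<forall>T i. interact \<beta>' h' T i = interact \<beta> h T i"
    by blast
  \<comment> \<open>Besides partial computability, the criterion depends on a learner only through
    its sequence of hypotheses.\<close>
  with h have "\<forall>L\<in>\<L>. learns \<phi> \<beta>' h' L" by (simp add: learns_def)
  with \<open>partial_computable h'\<close> show "\<L> \<in> learnable_classes \<phi> \<beta>'"
    by (auto simp: learnable_classes_def)
qed

lemma learnable_SetDriven_subset:
  "learnable_classes \<phi> SetDriven \<subseteq> learnable_classes \<phi> PartSetDriven"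
proof (rule learnable_classes_mono)
  fix h assume "partial_computable h"
  then have "partial_computable (\<lambda>z. h (pfst z))"
    by (rule partial_computable_comp) (intro computable)
  then show "\<exists>h'. partial_computable h' \<and>
      (\<forall>T i. interact PartSetDriven h' T i = interact SetDriven h T i)"
    by (intro exI[of _ "\<lambda>z. h (pfst z)"]) simp
qed

lemma learnable_PartSetDriven_subset:
  "learnable_classes \<phi> PartSetDriven \<subseteq> learnable_classes \<phi> Gold"
proof (rule learnable_classes_mono)
  fix h assume h: "partial_computable h"
  let ?h = "\<lambda>s. h (prod_encode (set_encode (content_list (decode_seq s)), length (list_decode s)))"
  have "partial_computable ?h"
    by (intro partial_computable_comp[OF h] computable_pair computable_set_encode_content
        computable_length_decode)
  moreover have "length (list_decode (code_seq (prefix T i))) = i" for T i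
    by (simp add: code_seq_def prefix_def)
  ultimately show "\<exists>h'. partial_computable h' \<and>
      (\<forall>T i. interact Gold h' T i = interact PartSetDriven h T i)"
    by (intro exI[of _ ?h]) simp
qed

text \<open>A witness consists of the index output by \<open>h\<close> and a value of that function
  at the given element; totality of \<open>h\<close> makes \<open>the\<close> return a genuine
  output.\<close>

lemma semidecidable_W:
  assumes "partial_computable2 \<phi>" "partial_computable h" "\<And>s. h s \<noteq> None"
  shows "semidecidable (\<lambda>z. psnd z \<in> W \<phi> (the (h (pfst z))))"
proof -
  obtain r q where r: "\<And>x z y. \<phi> x z = Some y \<longleftrightarrow> eval r [x, z] y"
    and q: "\<And>x y. h x = Some y \<longleftrightarrow> eval q [x] y"
    using assms(1,2) unfolding partial_computable2_def partial_computable_def by blast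
  have eq: "x \<in> W \<phi> (the (h s)) \<longleftrightarrow> (\<exists>e v. eval q [s] e \<and> eval r [e, x] v)" for x s
    using assms(3)[of s] unfolding W_def by (auto simp flip: q r)
  show ?thesis unfolding eq
    by (intro semidecidable_ex semidecidable_conj semidecidable_eval semidecidable_eval2 computable)
qed

lemma prefix_of_list: "prefix (\<lambda>i. if i < length \<sigma> then \<sigma> ! i else None) (length \<sigma>) = \<sigma>"
  by (rule nth_equalityI) (auto simp: prefix_def)

lemma learnable_Gold_subset:
  assumes "acceptable_numbering \<phi>"
  shows "learnable_classes \<phi> Gold \<subseteq> learnable_classes \<phi> SetDriven"
proof
  fix \<L> assume "\<L> \<in> learnable_classes \<phi> Gold"
  then obtain h where h: "partial_computable h" and learns: "\<And>L. L \<in> \<L> \<Longrightarrow> learns \<phi> Gold h L"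
    by (auto simp: learnable_classes_def)
  show "\<L> \<in> learnable_classes \<phi> SetDriven"
  \<comment> \<open>Totality and \<open>SemConv\<close> do not mention the language, but they are
    available only if the class is nonempty. For the empty class \<open>h\<close> itself
    suffices.\<close>
  proof (cases "\<L> = {}")
    case True
    with h show ?thesis by (auto simp: learnable_classes_def)
  next
    case False
    define A where "A \<sigma> = W \<phi> (the (h (code_seq \<sigma>)))" for \<sigma>
    from False learns have total: "h (code_seq (prefix T i)) \<noteq> None"
      and SemConv: "SemConv \<phi> (\<lambda>i. the (h (code_seq (prefix T i)))) T" for T i
      by (auto simp: learns_def)
    \<comment> \<open>Every number codes a prefix of some text, namely the decoded sequence followed
      by pauses.\<close>
    have h_total: "h s \<noteq> None" for s
      using total[of "\<lambda>i. if i < length (decode_seq s) then decode_seq s ! i else None"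
          "length (decode_seq s)"]
      unfolding prefix_of_list by simp
    interpret conservative A
    proof
      fix \<sigma> \<rho> assume sub: "content_list (\<sigma> @ \<rho>) \<subseteq> A \<sigma>"
      \<comment> \<open>The text \<open>?T\<close> presents \<open>\<sigma>\<close>, then
        \<open>\<rho>\<close>, then pauses, so both sequences to be compared are prefixes of
        it.\<close>
      let ?P = "\<lambda>i. if i < length \<rho> then \<rho> ! i else None"
      let ?T = "\<lambda>i. if i < length \<sigma> then \<sigma> ! i else ?P (i - length \<sigma>)"
      have "prefix ?P 0 = []" by (simp add: prefix_def)
      then have p: "prefix ?T (length \<sigma>) = \<sigma>" "prefix ?T (length \<sigma> + length \<rho>) = \<sigma> @ \<rho>"
        using prefix_append[of \<sigma> ?P 0] prefix_append[of \<sigma> ?P "length \<rho>", unfolded prefix_of_list]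
        by (simp_all only: add_0_right append_Nil2)
      show "A (\<sigma> @ \<rho>) = A \<sigma>"
      \<comment> \<open>\<open>SemConv\<close> compares only distinct stages, so an empty
        \<open>\<rho>\<close> is treated separately.\<close>
      proof (cases "\<rho> = []")
        case False
        then have "length \<sigma> < length \<sigma> + length \<rho>" by simp
        moreover have "content_list (prefix ?T (length \<sigma> + length \<rho>)) \<subseteq>
            W \<phi> (the (h (code_seq (prefix ?T (length \<sigma>)))))"
          using sub unfolding p A_def .
        ultimately have "W \<phi> (the (h (code_seq (prefix ?T (length \<sigma>))))) =
            W \<phi> (the (h (code_seq (prefix ?T (length \<sigma> + length \<rho>)))))"
          using SemConv[of ?T] unfolding SemConv_def by blast
        then show ?thesis unfolding p A_def by simp
      qed simp
    qed
    have "semidecidable (\<lambda>z. psnd z \<in> A (decode_seq (pfst z)))"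
      using semidecidable_W[OF _ h h_total] assms by (simp add: A_def acceptable_numbering_def)
    then have "semidecidable (\<lambda>z. psnd z \<in> conjecture (set_decode (pfst z)))"
      by (rule semidecidable_conjecture)
    \<comment> \<open>The conjectures form a uniformly enumerable family. Acceptability then turns
      the canonical index of a finite set computably into an index of its conjecture.\<close>
    then obtain \<psi> where "partial_computable2 \<psi>" and \<psi>: "\<And>d x. \<psi> d x \<noteq> None \<longleftrightarrow> x \<in> conjecture (set_decode d)"
      using semidecidable_domain[of "\<lambda>d x. x \<in> conjecture (set_decode d)"] by blast
    then obtain g where "total_computable g" and g: "\<And>d. \<psi> d = \<phi> (g d)"
      using assms unfolding acceptable_numbering_def by blast
    have W: "W \<phi> (g (set_encode (content_list \<sigma>))) = conjecture (content_list \<sigma>)" for \<sigma>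
      unfolding W_def g[symmetric] \<psi> by simp
    define h' where "h' d = Some (g d)" for d
    have h': "partial_computable h'"
      using \<open>total_computable g\<close> by (simp add: total_computable_def h'_def[abs_def])
    have "learns \<phi> SetDriven h' L" if "L \<in> \<L>" for L
      unfolding learns_def
    proof (intro conjI allI impI)
      fix T
      show "SemConv \<phi> (\<lambda>i. the (interact SetDriven h' T i)) T"
        unfolding SemConv_def
      proof (intro allI impI)
        fix n m assume nm: "n < m \<and> content_list (prefix T m) \<subseteq> W \<phi> (the (interact SetDriven h' T n))"
        \<comment> \<open>Contents of prefixes grow along a text, which gives the first inclusion
          required by \<open>conjecture_conservative\<close>.\<close>
        then have "content_list (prefix T n) \<subseteq> content_list (prefix T m)"
          unfolding content_list_prefix by (blast intro: less_trans)
        with nm show "W \<phi> (the (interact SetDriven h' T n)) = W \<phi> (the (interact SetDriven h' T m))"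
          using conjecture_conservative by (simp add: h'_def W)
      qed
    next
      fix T assume T: "content T = L"
      have "\<exists>n0. \<forall>n\<ge>n0. A (prefix S n) = L" if "content S = L" for S
        using learns[OF \<open>L \<in> \<L>\<close>] that by (auto simp: learns_def Bc_def A_def)
      then obtain D\<^sub>0 where D\<^sub>0: "finite D\<^sub>0" "D\<^sub>0 \<subseteq> L"
        "\<And>D. D\<^sub>0 \<subseteq> D \<Longrightarrow> D \<subseteq> L \<Longrightarrow> conjecture D = L"
        using conjecture_learns[of L] by blast
      have "\<exists>i. T i = Some x" if "x \<in> D\<^sub>0" for x
        using that D\<^sub>0(2) T by (auto simp: content_def)
      then obtain i where i: "\<And>x. x \<in> D\<^sub>0 \<Longrightarrow> T (i x) = Some x" by metis
      \<comment> \<open>\<open>N\<close> is a stage by which the text has listed all of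
        \<open>D\<^sub>0\<close>.\<close>
      obtain N where N: "\<And>x. x \<in> D\<^sub>0 \<Longrightarrow> i x < N"
        using D\<^sub>0(1) finite_nat_set_iff_bounded[of "i ` D\<^sub>0"] by auto
      have "conjecture (content_list (prefix T n)) = L" if "n \<ge> N" for n
      proof (rule D\<^sub>0(3))
        show "D\<^sub>0 \<subseteq> content_list (prefix T n)"
          unfolding content_list_prefix using i less_le_trans[OF N that] by blast
        show "content_list (prefix T n) \<subseteq> L"
          using T by (auto simp: content_list_prefix content_def)
      qed
      then show "Bc \<phi> (\<lambda>i. the (interact SetDriven h' T i)) T"
        by (auto simp: Bc_def h'_def W T)
    qed (use h' in \<open>simp_all add: h'_def\<close>)
    with h' show ?thesis by (auto simp: learnable_classes_def)
  qed
qed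

theorem theorem13:
  assumes "acceptable_numbering \<phi>"
  shows "learnable_classes \<phi> SetDriven = learnable_classes \<phi> PartSetDriven
       \<and> learnable_classes \<phi> PartSetDriven = learnable_classes \<phi> Gold"
  using learnable_SetDriven_subset learnable_PartSetDriven_subset learnable_Gold_subset[OF assms]
  by blast

end
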